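(* Let $T$ be a stopping time and let $U=\inf\{u>T: u=\tau(k)\text{ for some }k\ge1\}$. For $\theta\in\Theta$ define $$Z_n(\theta)=\begin{cases}e^{\theta'S_n-n\psi(\theta)}\,r(X_n;\theta), & n<U,\\ e^{\theta'S_U-U\psi(\theta)}, & n\ge U.\end{cases}$$ Let $\mathcal{G}_n$ be the smallest $\sigma$-field containing $\mathcal{F}_n\cup\sigma\{\tau(k)\mathbf{1}_{\{\tau(k)\le n\}},\,k\ge1\}$. Then $\{Z_n(\theta)\}$ is a martingale with respect to $\{\mathcal{G}_n\}$ under the transition kernel $P$.
   Context: A prime denotes transpose. $\{(X_n,S_n):n=0,1,\ldots\}$ is a Markov additive process on $\mathcal{X}\times\mathbf{R}^d$ with transition kernel $P(x,A\times B)=P\{(X_1,S_1)\in A\times(B+s)\mid(X_0,S_0)=(x,s)\}$, not depending on $s$; $S_0=0$, $\xi_n=S_n-S_{n-1}$. $\{X_n\}$ is aperiodic and irreducible with respect to a maximal irreducibility measure $\varphi$. $\mathcal{F}_n$ is the $\sigma$-field generated by $X_0,\ldots,X_n,\xi_1,\ldots,\xi_n$, and stopping times are with respect to $(\mathcal F_n)$. $E_x$, $E_\nu$ denote expectation with $X_0=x$, $X_0\sim\nu$. Minorization: $P(x,A\times B)\ge h(x,B)\nu(A)$ for some probability measure $\nu$ on $\mathcal{X}$ and measures $h(x,\cdot)$ on $\mathbf{R}^d$ that are positive for all $x$ in a $\varphi$-positive set. Regeneration times $0=\tau(0)<\tau=\tau(1)<\tau(2)<\cdots$ are those of the associated split chain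 (Ney–Nummelin): given the past up to time $n-1$ with $X_{n-1}=x$, with probability $h(x,\mathbf{R}^d)$ time $n$ is a regeneration time and $(X_n,\xi_n)$ has law $\nu\times h(x,\cdot)/h(x,\mathbf{R}^d)$; otherwise $(X_n,\xi_n)$ is drawn from the normalized residual kernel. For $k\ge1$: $\tau(k+1)-\tau(k)$ are i.i.d.; the blocks $\{X_{\tau(k)},\ldots,X_{\tau(k+1)-1},\xi_{\tau(k)+1},\ldots,\xi_{\tau(k+1)}\}$ are independent; $P_x\{X_{\tau(k)}\in A\mid\mathcal{F}_{\tau(k)-1},\xi_{\tau(k)}\}=\nu(A)$; and for each $n\ge1$ there is a measure $h_n(x,\cdot)$ with $P_x\{\tau=n,(X_n,\xi_n)\in A\times B\}=\nu(A)h_n(x,B)$. It is assumed that $\Omega:=\{(\theta,\zeta)\in\mathbf{R}^d\times\mathbf{R}:E_\nu e^{\theta'S_\tau-\tau\zeta}<\infty\}$ is an open neighborhood of $0$. $\Theta=\{\theta:(\theta,\zeta)\in\Omega\text{ for some }\zeta\}$; for $\theta\in\Theta$, $\psi(\theta)$ is the unique solution of $E_\nu e^{\theta'S_\tau-\tau\psi(\theta)}=1$, and $r(x;\theta)=E_xe^{\theta'S_\tau-\tau\psi(\theta)}$ is the eigenfunction, with eigenvalue $e^{\psi(\theta)}$, of the kernel $\widehat P_\theta(x,A)=\int e^{\theta's}P(x,A\times ds)$. There is a full set $F$ (i.e. $\varphi(F^c)=0$) with $E_xe^{\theta'S_\tau-\tau\zeta}<\infty$ for all $x\in F$, $(\theta,\zeta)\in\Omega$.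 The initial state $X_0=x_0$ belongs to $F$. *)

theory Defs
  imports "HOL-Probability.Probability"
begin

primrec kernel_pow :: "'x measure \<Rightarrow> ('x \<Rightarrow> 'x measure) \<Rightarrow> nat \<Rightarrow> 'x \<Rightarrow> 'x measure" where
  "kernel_pow \<X> K 0 x = return \<X> x"
| "kernel_pow \<X> K (Suc n) x = K x \<bind> kernel_pow \<X> K n"

definition irreducibility_measure ::
    "'x measure \<Rightarrow> ('x \<Rightarrow> 'x measure) \<Rightarrow> 'x measure \<Rightarrow> bool" where
  "irreducibility_measure \<X> K \<phi> \<longleftrightarrow>
     sets \<phi> = sets \<X> \<and> sigma_finite_measure \<phi> \<and> emeasure \<phi> (space \<phi>) > 0 \<and>
     (\<forall>x\<in>space \<X>. \<forall>A\<in>sets \<X>. emeasure \<phi> A > 0 \<longrightarrow>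
        (\<exists>n\<ge>1. emeasure (kernel_pow \<X> K n x) A > 0))"

definition maximal_irreducibility_measure ::
    "'x measure \<Rightarrow> ('x \<Rightarrow> 'x measure) \<Rightarrow> 'x measure \<Rightarrow> bool" where
  "maximal_irreducibility_measure \<X> K \<phi> \<longleftrightarrow>
     irreducibility_measure \<X> K \<phi> \<and>
     (\<forall>\<phi>'. irreducibility_measure \<X> K \<phi>' \<longrightarrow> absolutely_continuous \<phi> \<phi>')"

text \<open>Aperiodicity in the sense of general state spaces: there is no \<open>d\<close>-cycle with
  \<open>d \<ge> 2\<close> whose union is full.\<close>

definition aperiodic_kernel ::
    "'x measure \<Rightarrow> ('x \<Rightarrow> 'x measure) \<Rightarrow> 'x measure \<Rightarrow> bool" where
  "aperiodic_kernel \<X> K \<phi> \<longleftrightarrow>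
     \<not> (\<exists>d\<ge>2. \<exists>D :: nat \<Rightarrow> 'x set.
          (\<forall>i<d. D i \<in> sets \<X>) \<and> disjoint_family_on D {..<d} \<and>
          (\<forall>i<d. \<forall>x\<in>D i. emeasure (K x) (D (Suc i mod d)) = 1) \<and>
          emeasure \<phi> (space \<X> - (\<Union>i<d. D i)) = 0)"

definition full_set :: "'x measure \<Rightarrow> 'x measure \<Rightarrow> 'x set \<Rightarrow> bool" where
  "full_set \<X> \<phi> F \<longleftrightarrow> F \<in> sets \<X> \<and> emeasure \<phi> (space \<X> - F) = 0"

definition incr :: "(nat \<Rightarrow> 'w \<Rightarrow> 'v::euclidean_space) \<Rightarrow> nat \<Rightarrow> 'w \<Rightarrow> 'v" where
  "incr S n \<omega> = S n \<omega> - S (n - 1) \<omega>"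

text \<open>\<open>Y n \<omega>\<close> (for \<open>n \<ge> 1\<close>) says that the split chain regenerates at time \<open>n\<close>; \<open>regen_time Y k\<close>
  is the \<open>k\<close>-th regeneration time, with value \<open>\<infinity>\<close> if there are fewer than \<open>k\<close> regenerations.\<close>

primrec regen_time :: "(nat \<Rightarrow> 'w \<Rightarrow> bool) \<Rightarrow> nat \<Rightarrow> 'w \<Rightarrow> enat" where
  "regen_time Y 0 \<omega> = 0"
| "regen_time Y (Suc k) \<omega> = Inf {enat n | n. regen_time Y k \<omega> < enat n \<and> Y n \<omega>}"

definition map_filtration ::
    "'w measure \<Rightarrow> 'x measure \<Rightarrow> (nat \<Rightarrow> 'w \<Rightarrow> 'x) \<Rightarrow> (nat \<Rightarrow> 'w \<Rightarrow> 'v::euclidean_space)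
      \<Rightarrow> nat \<Rightarrow> 'w measure" where
  "map_filtration W \<X> X S n = sigma (space W)
     ((\<Union>i\<in>{0..n}. {X i -` A \<inter> space W | A. A \<in> sets \<X>}) \<union>
      (\<Union>i\<in>{1..n}. {incr S i -` B \<inter> space W | B. B \<in> sets borel}))"

definition regen_filtration ::
    "'w measure \<Rightarrow> 'x measure \<Rightarrow> (nat \<Rightarrow> 'w \<Rightarrow> 'x) \<Rightarrow> (nat \<Rightarrow> 'w \<Rightarrow> 'v::euclidean_space)
      \<Rightarrow> (nat \<Rightarrow> 'w \<Rightarrow> bool) \<Rightarrow> nat \<Rightarrow> 'w measure" where
  "regen_filtration W \<X> X S Y n = sigma (space W)
     (sets (map_filtration W \<X> X S n) \<union>
      (\<Union>k\<in>{1..}.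
         {(\<lambda>\<omega>. if regen_time Y k \<omega> \<le> enat n then the_enat (regen_time Y k \<omega>) else 0) -` B
            \<inter> space W | B :: nat set. True}))"

definition extended_stopping_time ::
    "'w measure \<Rightarrow> (nat \<Rightarrow> 'w measure) \<Rightarrow> ('w \<Rightarrow> enat) \<Rightarrow> bool" where
  "extended_stopping_time W F T \<longleftrightarrow> (\<forall>n. {\<omega> \<in> space W. T \<omega> \<le> enat n} \<in> sets (F n))"

definition martingale :: "'w measure \<Rightarrow> (nat \<Rightarrow> 'w measure) \<Rightarrow> (nat \<Rightarrow> 'w \<Rightarrow> real) \<Rightarrow> bool" where
  "martingale M F Z \<longleftrightarrow>
     filtration (space M) F \<and> (\<forall>n. subalgebra M (F n)) \<and>
     (\<forall>n. Z n \<in> borel_measurable (F n)) \<and>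
     (\<forall>n. integrable M (Z n)) \<and>
     (\<forall>m n. m \<le> n \<longrightarrow> (AE \<omega> in M. real_cond_exp M (F m) (Z n) \<omega> = Z m \<omega>))"

text \<open>\<open>P x\<close> is the joint law of \<open>(X\<^sub>1, \<xi>\<^sub>1)\<close> given \<open>X\<^sub>0 = x\<close>. The rectangle inequality forces
  \<open>h x\<close> to have total mass at most 1.\<close>

locale minorized_kernel =
  fixes \<X> :: "'x measure"
    and P :: "'x \<Rightarrow> ('x \<times> 'v::euclidean_space) measure"
    and \<phi> :: "'x measure"
    and \<nu> :: "'x measure"
    and h :: "'x \<Rightarrow> 'v measure"
  assumes kernel: "P \<in> \<X> \<rightarrow>\<^sub>M prob_algebra (\<X> \<Otimes>\<^sub>M borel)"
    and irreducible: "maximal_irreducibility_measure \<X> (\<lambda>x. distr (P x) \<X> fst) \<phi>"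
    and aperiodic: "aperiodic_kernel \<X> (\<lambda>x. distr (P x) \<X> fst) \<phi>"
    and nu: "\<nu> \<in> space (prob_algebra \<X>)"
    and h_kernel: "h \<in> \<X> \<rightarrow>\<^sub>M subprob_algebra borel"
    and h_pos: "\<exists>C\<in>sets \<X>. emeasure \<phi> C > 0 \<and> (\<forall>x\<in>C. emeasure (h x) UNIV > 0)"
    and minorization: "\<And>x A B. x \<in> space \<X> \<Longrightarrow> A \<in> sets \<X> \<Longrightarrow> B \<in> sets borel \<Longrightarrow>
      emeasure (P x) (A \<times> B) \<ge> emeasure (h x) B * emeasure \<nu> A"

text \<open>\<open>Pr \<mu>\<close> is the law of the split chain with initial distribution \<open>\<mu>\<close>, all laws living on one
  measurable space \<open>W\<close>; \<open>Pr (return \<X> x)\<close> is the law started at \<open>x\<close>.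

  In \<open>regeneration\<close> and \<open>residual\<close> the mixture weights are multiplied out: a regeneration has
  conditional probability \<open>h x UNIV\<close> and then \<open>(X, \<xi>)\<close> has law \<open>\<nu> \<times> h x / h x UNIV\<close>; otherwise,
  with conditional probability \<open>1 - h x UNIV\<close>, it has law \<open>(P x - \<nu> \<times> h x) / (1 - h x UNIV)\<close>.
  Adding the two equations gives the Markov additive property with kernel \<open>P\<close>. The conditioning
  \<open>\<sigma>\<close>-field is generated by the path and the regeneration times up to time \<open>n\<close>.\<close>

locale split_chain = minorized_kernel \<X> P \<phi> \<nu> h
  for \<X> :: "'x measure"
    and P :: "'x \<Rightarrow> ('x \<times> 'v::euclidean_space) measure"
    and \<phi> :: "'x measure"
    and \<nu> :: "'x measure"
    and h :: "'x \<Rightarrow> 'v measure" +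
  fixes W :: "'w measure"
    and Pr :: "'x measure \<Rightarrow> 'w measure"
    and X :: "nat \<Rightarrow> 'w \<Rightarrow> 'x"
    and S :: "nat \<Rightarrow> 'w \<Rightarrow> 'v"
    and Y :: "nat \<Rightarrow> 'w \<Rightarrow> bool"
  assumes X_measurable: "\<And>n. X n \<in> W \<rightarrow>\<^sub>M \<X>"
    and S_measurable: "\<And>n. S n \<in> borel_measurable W"
    and Y_measurable: "\<And>n. Y n \<in> W \<rightarrow>\<^sub>M count_space UNIV"
    and S_0: "\<And>\<omega>. \<omega> \<in> space W \<Longrightarrow> S 0 \<omega> = 0"
    and law: "\<And>\<mu>. \<mu> \<in> space (prob_algebra \<X>) \<Longrightarrow> Pr \<mu> \<in> space (prob_algebra W)"
    and initial: "\<And>\<mu>. \<mu> \<in> space (prob_algebra \<X>) \<Longrightarrow> distr (Pr \<mu>) \<X> (X 0) = \<mu>"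
    and regeneration: "\<And>\<mu> n A B.
      \<mu> \<in> space (prob_algebra \<X>) \<Longrightarrow> A \<in> sets \<X> \<Longrightarrow> B \<in> sets borel \<Longrightarrow>
      AE \<omega> in Pr \<mu>.
        real_cond_exp (Pr \<mu>) (regen_filtration W \<X> X S Y n)
          (indicator {\<omega> \<in> space W. Y (Suc n) \<omega> \<and> X (Suc n) \<omega> \<in> A \<and> incr S (Suc n) \<omega> \<in> B}) \<omega>
        = measure \<nu> A * measure (h (X n \<omega>)) B"
    and residual: "\<And>\<mu> n A B.
      \<mu> \<in> space (prob_algebra \<X>) \<Longrightarrow> A \<in> sets \<X> \<Longrightarrow> B \<in> sets borel \<Longrightarrow>
      AE \<omega> in Pr \<mu>.
        real_cond_exp (Pr \<mu>) (regen_filtration W \<X> X S Y n)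
          (indicator {\<omega> \<in> space W. \<not> Y (Suc n) \<omega> \<and> X (Suc n) \<omega> \<in> A \<and> incr S (Suc n) \<omega> \<in> B}) \<omega>
        = measure (P (X n \<omega>)) (A \<times> B) - measure \<nu> A * measure (h (X n \<omega>)) B"

text \<open>Here \<open>Q\<close> is a law of the split chain. The expectation is taken in \<open>[0, \<infinity>]\<close>. The value \<open>0\<close> on
  \<open>{\<tau> = \<infinity>}\<close> is a dummy, to be used when \<open>\<tau>\<close> is \<open>Q\<close>-almost surely finite.\<close>

definition cycle_mgf ::
    "'w measure \<Rightarrow> (nat \<Rightarrow> 'w \<Rightarrow> 'v::euclidean_space) \<Rightarrow> (nat \<Rightarrow> 'w \<Rightarrow> bool)
      \<Rightarrow> 'v \<Rightarrow> real \<Rightarrow> ennreal" where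
  "cycle_mgf Q S Y \<theta> \<zeta> =
     (\<integral>\<^sup>+ \<omega>. (case regen_time Y 1 \<omega> of
               enat n \<Rightarrow> ennreal (exp (\<theta> \<bullet> S n \<omega> - real n * \<zeta>))
             | \<infinity> \<Rightarrow> 0) \<partial>Q)"

definition mgf_domain ::
    "'w measure \<Rightarrow> (nat \<Rightarrow> 'w \<Rightarrow> 'v::euclidean_space) \<Rightarrow> (nat \<Rightarrow> 'w \<Rightarrow> bool)
      \<Rightarrow> ('v \<times> real) set" where
  "mgf_domain Q S Y = {(\<theta>, \<zeta>). cycle_mgf Q S Y \<theta> \<zeta> < \<infinity>}"

definition tilt_domain ::
    "'w measure \<Rightarrow> (nat \<Rightarrow> 'w \<Rightarrow> 'v::euclidean_space) \<Rightarrow> (nat \<Rightarrow> 'w \<Rightarrow> bool) \<Rightarrow> 'v set" where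
  "tilt_domain Q S Y = {\<theta>. \<exists>\<zeta>. (\<theta>, \<zeta>) \<in> mgf_domain Q S Y}"

definition cycle_psi ::
    "'w measure \<Rightarrow> (nat \<Rightarrow> 'w \<Rightarrow> 'v::euclidean_space) \<Rightarrow> (nat \<Rightarrow> 'w \<Rightarrow> bool) \<Rightarrow> 'v \<Rightarrow> real" where
  "cycle_psi Q S Y \<theta> = (THE \<zeta>. cycle_mgf Q S Y \<theta> \<zeta> = 1)"

definition eigenfun ::
    "'x measure \<Rightarrow> 'x measure \<Rightarrow> ('x measure \<Rightarrow> 'w measure) \<Rightarrow> (nat \<Rightarrow> 'w \<Rightarrow> 'v::euclidean_space)
      \<Rightarrow> (nat \<Rightarrow> 'w \<Rightarrow> bool) \<Rightarrow> 'v \<Rightarrow> 'x \<Rightarrow> real" where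
  "eigenfun \<X> \<nu> Pr S Y \<theta> x =
     enn2real (cycle_mgf (Pr (return \<X> x)) S Y \<theta> (cycle_psi (Pr \<nu>) S Y \<theta>))"

definition next_regen :: "(nat \<Rightarrow> 'w \<Rightarrow> bool) \<Rightarrow> ('w \<Rightarrow> enat) \<Rightarrow> 'w \<Rightarrow> enat" where
  "next_regen Y T \<omega> = Inf {u. u > T \<omega> \<and> (\<exists>k\<ge>1. u = regen_time Y k \<omega>)}"

definition tilted_process ::
    "'x measure \<Rightarrow> 'x measure \<Rightarrow> ('x measure \<Rightarrow> 'w measure) \<Rightarrow> (nat \<Rightarrow> 'w \<Rightarrow> 'x)
      \<Rightarrow> (nat \<Rightarrow> 'w \<Rightarrow> 'v::euclidean_space) \<Rightarrow> (nat \<Rightarrow> 'w \<Rightarrow> bool) \<Rightarrow> ('w \<Rightarrow> enat)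
      \<Rightarrow> 'v \<Rightarrow> nat \<Rightarrow> 'w \<Rightarrow> real" where
  "tilted_process \<X> \<nu> Pr X S Y T \<theta> n \<omega> =
     (let \<psi> = cycle_psi (Pr \<nu>) S Y \<theta>; U = next_regen Y T \<omega> in
      if enat n < U
      then exp (\<theta> \<bullet> S n \<omega> - real n * \<psi>) * eigenfun \<X> \<nu> Pr S Y \<theta> (X n \<omega>)
      else exp (\<theta> \<bullet> S (the_enat U) \<omega> - real (the_enat U) * \<psi>))"

end

theory Submission
  imports Defs
begin

text \<open>
  Write \<open>\<tau>\<close> for the first regeneration time, \<open>r x\<close> for the expectation of
  \<open>exp (\<theta> \<bullet> S\<^sub>\<tau> - \<tau> \<psi>)\<close> under the law started at \<open>x\<close>, and \<open>e\<close> for the one-step weight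
  \<open>exp (\<theta> \<bullet> \<xi> - \<psi>)\<close>. What has to be shown is that the conditional mean of the process
  at time \<open>n + 1\<close> given the past up to time \<open>n\<close> is its value at time \<open>n\<close>. On
  \<open>n \<ge> U\<close> it is frozen and there is nothing to show. On \<open>n < U\<close> there are two cases, according to what a regeneration at time \<open>n + 1\<close> would do.

  \<^item> If \<open>T \<le> n\<close>, then a regeneration at \<open>n + 1\<close> makes \<open>U = n + 1\<close>, so besides \<open>e\<close> the new value
    carries the factor \<open>1\<close> on regeneration and \<open>r (X\<^sub>n\<^sub>+\<^sub>1)\<close> otherwise. This is exactly the
    decomposition of \<open>r\<close> over the first step of a cycle (\<open>cycle_fun_first_step\<close>).
  \<^item> If \<open>T > n\<close>, then \<open>U > n + 1\<close> whatever happens, and the factor besides \<open>e\<close> is \<open>r (X\<^sub>n\<^sub>+\<^sub>1)\<close> in both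
    cases. A regeneration puts \<open>X\<^sub>n\<^sub>+\<^sub>1\<close> at a fresh \<open>\<nu>\<close>-distributed point, independent of the increment, and
    \<open>\<integral> r d\<nu> = 1\<close> by the choice of \<open>\<psi>\<close>. So replacing the factor \<open>r (X\<^sub>n\<^sub>+\<^sub>1)\<close> by \<open>1\<close> on regeneration
    does not change the mean (\<open>cycle_fun_at_regeneration\<close>), which leads back to the first case.

  That \<open>\<psi>\<close> is a genuine solution of \<open>E\<^sub>\<nu> exp (\<theta> \<bullet> S\<^sub>\<tau> - \<tau> \<psi>) = 1\<close> is a fact about Laplace
  transforms of a variable that is at least \<open>1\<close> (\<open>laplace_transform_root\<close>); openness of the domain
  of finiteness is what keeps the transform from jumping from a value below \<open>1\<close> straight to infinity.

  All computations take place in \<open>[0, \<infinity>]\<close>, where \<open>r\<close> is a series of kernel iterates and every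
  exchange of sum and integral is free. Real numbers enter only at the end: the expectation
  of the process is constant in time and equal to \<open>r x\<^sub>0 < \<infinity>\<close>, so the process is almost surely
  finite and integrable (\<open>martingale_enn2real\<close>). Thereby the states at which \<open>r\<close> is infinite, where the
  real-valued eigenfunction takes the dummy value \<open>0\<close>, need no separate treatment.
\<close>

section \<open>Regeneration times\<close>

lemma Inf_enat_eq_enat_iff:
  "Inf {enat n | n. Q n} = enat m \<longleftrightarrow> Q m \<and> (\<forall>j<m. \<not> Q j)"
proof (cases "\<exists>n. Q n")
  case True
  define l where "l = (LEAST n. Q n)"
  have l: "Q l" "\<And>j. Q j \<Longrightarrow> l \<le> j"
    using True unfolding l_def by (auto intro: LeastI_ex Least_le)
  have "Inf {enat n | n. Q n} = enat l"
    by (rule antisym) (auto intro!: Inf_lower Inf_greatest l)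
  moreover have "Q m \<and> (\<forall>j<m. \<not> Q j) \<longleftrightarrow> l = m"
    using l by (metis le_antisym linorder_not_less)
  ultimately show ?thesis by simp
next
  case False
  then have "{enat n | n. Q n} = {}" by auto
  then show ?thesis using False by (simp add: Inf_enat_def)
qed

lemma regen_time_Suc_eq_enat_iff:
  "regen_time Y (Suc k) \<omega> = enat n \<longleftrightarrow>
     regen_time Y k \<omega> < enat n \<and> Y n \<omega> \<and> (\<forall>j<n. \<not> (regen_time Y k \<omega> < enat j \<and> Y j \<omega>))"
  by (simp add: Inf_enat_eq_enat_iff)

lemma regen_time_ge: "enat k \<le> regen_time Y k \<omega>"
proof (induction k)
  case (Suc k)
  have "enat (Suc k) \<le> enat n" if "regen_time Y k \<omega> < enat n" for n
    using le_less_trans[OF Suc that] by simp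
  then show ?case by (auto intro!: Inf_greatest)
qed (simp add: zero_enat_def)

text \<open>The recursively defined regeneration times enumerate the regeneration events, so they can be
  eliminated in favour of \<open>Y\<close>, whose one-step law is given.\<close>

lemma ex_regen_time_eq_iff:
  "(\<exists>k\<ge>1. regen_time Y k \<omega> = enat u) \<longleftrightarrow> 1 \<le> u \<and> Y u \<omega>"
proof
  assume "\<exists>k\<ge>1. regen_time Y k \<omega> = enat u"
  then obtain k where "regen_time Y (Suc k) \<omega> = enat u" by (metis Suc_le_D One_nat_def)
  then show "1 \<le> u \<and> Y u \<omega>"
    unfolding regen_time_Suc_eq_enat_iff by (cases u) (auto simp flip: zero_enat_def)
next
  assume u: "1 \<le> u \<and> Y u \<omega>"
  show "\<exists>k\<ge>1. regen_time Y k \<omega> = enat u"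
  proof (rule ccontr)
    assume missed: "\<not> (\<exists>k\<ge>1. regen_time Y k \<omega> = enat u)"
    \<comment> \<open>A missed \<open>u\<close> would lie beyond all regeneration times, which is absurd since the
      \<open>k\<close>-th one is at least \<open>k\<close>.\<close>
    have "regen_time Y k \<omega> < enat u" for k
    proof (induction k)
      case 0
      then show ?case using u by (simp add: zero_enat_def)
    next
      case (Suc k)
      then have "regen_time Y (Suc k) \<omega> \<le> enat u"
        using u by (auto intro!: Inf_lower)
      then show ?case using missed by (metis One_nat_def Suc_le_mono le0 order_le_less)
    qed
    from this[of u] regen_time_ge[of u Y \<omega>] show False by simp
  qed
qed

lemma regen_time_1_eq_iff:
  "regen_time Y 1 \<omega> = enat n \<longleftrightarrow> 1 \<le> n \<and> Y n \<omega> \<and> (\<forall>j. 1 \<le> j \<and> j < n \<longrightarrow> \<not> Y j \<omega>)"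
  unfolding One_nat_def regen_time_Suc_eq_enat_iff
  by (auto simp: zero_enat_def Suc_le_eq)

text \<open>The finite regeneration times are exactly the times \<open>u \<ge> 1\<close> with \<open>Y u\<close>, so \<open>U\<close> is the first such
  time after \<open>T\<close>.\<close>

lemma next_regen_eq_enat_iff:
  "next_regen Y T \<omega> = enat u \<longleftrightarrow>
     T \<omega> < enat u \<and> Y u \<omega> \<and> (\<forall>j<u. \<not> (T \<omega> < enat j \<and> Y j \<omega>))"
proof -
  let ?Q = "\<lambda>n. T \<omega> < enat n \<and> Y n \<omega>"
  let ?A = "{v. v > T \<omega> \<and> (\<exists>k\<ge>1. v = regen_time Y k \<omega>)}"
  have fin: "enat n \<in> ?A \<longleftrightarrow> ?Q n" for n
  proof -
    have "1 \<le> n" if "T \<omega> < enat n" using that by (cases n) (auto simp flip: zero_enat_def)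
    then show ?thesis using ex_regen_time_eq_iff[of Y \<omega> n] by auto
  qed
  have "Inf ?A = Inf {enat n | n. ?Q n}"
  proof (rule antisym)
    have "v \<in> ?A" if "v \<in> {enat n | n. ?Q n}" for v
    proof -
      from that obtain n where "v = enat n" "?Q n" by blast
      then show ?thesis using fin[of n] by (simp only:)
    qed
    then show "Inf ?A \<le> Inf {enat n | n. ?Q n}" by (intro Inf_superset_mono subsetI)
    show "Inf {enat n | n. ?Q n} \<le> Inf ?A"
    proof (rule Inf_greatest)
      fix v assume v: "v \<in> ?A"
      show "Inf {enat n | n. ?Q n} \<le> v"
      proof (cases v)
        case (enat n)
        then have "?Q n" using fin[of n] v by (simp only:)
        then show ?thesis unfolding enat by (intro Inf_lower) blast
      qed simp
    qed
  qed
  then show ?thesis unfolding next_regen_def by (simp add: Inf_enat_eq_enat_iff)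
qed

lemma less_next_regen_iff:
  "enat n < next_regen Y T \<omega> \<longleftrightarrow> (\<forall>j\<le>n. \<not> (T \<omega> < enat j \<and> Y j \<omega>))"
proof
  assume less: "enat n < next_regen Y T \<omega>"
  show "\<forall>j\<le>n. \<not> (T \<omega> < enat j \<and> Y j \<omega>)"
  proof (intro allI impI notI)
    fix j assume j: "j \<le> n" "T \<omega> < enat j \<and> Y j \<omega>"
    let ?Q = "\<lambda>j. T \<omega> < enat j \<and> Y j \<omega>"
    define u where "u = (LEAST j. ?Q j)"
    have "T \<omega> < enat u \<and> Y u \<omega>" unfolding u_def by (rule LeastI[of ?Q, OF j(2)])
    moreover have "\<not> (T \<omega> < enat i \<and> Y i \<omega>)" if "i < u" for i
      using not_less_Least that unfolding u_def by blast
    ultimately have "next_regen Y T \<omega> = enat u" by (simp add: next_regen_eq_enat_iff)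
    moreover have "u \<le> j" unfolding u_def by (rule Least_le[of ?Q, OF j(2)])
    ultimately show False using less j(1) by simp
  qed
next
  assume none: "\<forall>j\<le>n. \<not> (T \<omega> < enat j \<and> Y j \<omega>)"
  show "enat n < next_regen Y T \<omega>"
  proof (cases "next_regen Y T \<omega>")
    case (enat u)
    then have "T \<omega> < enat u \<and> Y u \<omega>" by (simp add: next_regen_eq_enat_iff)
    with none have "n < u" by (meson not_le)
    then show ?thesis by (simp add: enat)
  qed simp
qed

section \<open>Unit level of a Laplace transform\<close>

text \<open>Increasing \<open>\<zeta>\<close> by \<open>c \<ge> 0\<close> shrinks \<open>g\<close> by a factor of at least \<open>exp c\<close>, because \<open>N \<ge> 1\<close>. This
  gives uniqueness, values below \<open>1\<close> far to the right of \<open>\<zeta>0\<close>, and values above \<open>1\<close> far to the left.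
  The root is the infimum of \<open>{\<zeta>. g \<zeta> \<le> 1}\<close>. Continuity there is needed from both sides; on the left
  it could fail only by a jump to \<open>\<infinity>\<close>, which openness excludes.\<close>

lemma laplace_transform_root:
  fixes M :: "'a measure" and f N :: "'a \<Rightarrow> real"
  defines "g \<equiv> \<lambda>\<zeta>. \<integral>\<^sup>+\<omega>. ennreal (exp (f \<omega> - N \<omega> * \<zeta>)) \<partial>M"
  assumes [measurable]: "f \<in> borel_measurable M" "N \<in> borel_measurable M"
    and N: "AE \<omega> in M. 1 \<le> N \<omega>"
    and nontrivial: "emeasure M (space M) \<noteq> 0"
    and "open": "open {\<zeta>. g \<zeta> < \<infinity>}"
    and finite: "g \<zeta>0 < \<infinity>"
  shows "\<exists>!\<zeta>. g \<zeta> = 1"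
proof -
  have contract: "g \<beta> \<le> ennreal (exp (\<alpha> - \<beta>)) * g \<alpha>" if "\<alpha> \<le> \<beta>" for \<alpha> \<beta>
  proof -
    have "exp (f \<omega> - N \<omega> * \<beta>) \<le> exp (\<alpha> - \<beta>) * exp (f \<omega> - N \<omega> * \<alpha>)" if "1 \<le> N \<omega>" for \<omega>
    proof -
      have "1 * (\<beta> - \<alpha>) \<le> N \<omega> * (\<beta> - \<alpha>)"
        using that \<open>\<alpha> \<le> \<beta>\<close> by (intro mult_right_mono) auto
      then have "f \<omega> - N \<omega> * \<beta> \<le> (\<alpha> - \<beta>) + (f \<omega> - N \<omega> * \<alpha>)" by (simp add: algebra_simps)
      then show ?thesis unfolding exp_add[symmetric] by (subst exp_le_cancel_iff)
    qed
    then have "g \<beta> \<le> (\<integral>\<^sup>+\<omega>. ennreal (exp (\<alpha> - \<beta>)) * ennreal (exp (f \<omega> - N \<omega> * \<alpha>)) \<partial>M)"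
      unfolding g_def using N
      by (intro nn_integral_mono_AE) (auto simp flip: ennreal_mult elim!: eventually_mono)
    also have "\<dots> = ennreal (exp (\<alpha> - \<beta>)) * g \<alpha>"
      unfolding g_def by (rule nn_integral_cmult) simp
    finally show ?thesis .
  qed
  have pos: "g \<alpha> \<noteq> 0" for \<alpha>
  proof
    assume "g \<alpha> = 0"
    then have "AE \<omega> in M. False" unfolding g_def by (subst (asm) nn_integral_0_iff_AE) auto
    then show False using nontrivial by (subst (asm) AE_iff_measurable[OF sets.top]) auto
  qed
  define A where "A = {\<alpha>. g \<alpha> \<le> 1}"
  have A_up: "\<beta> \<in> A" if "\<alpha> \<in> A" "\<alpha> \<le> \<beta>" for \<alpha> \<beta>
  proof -
    have "ennreal (exp (\<alpha> - \<beta>)) * g \<alpha> \<le> 1 * 1"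
      using that by (intro mult_mono) (auto simp: A_def)
    with contract[OF that(2)] show ?thesis by (simp add: A_def)
  qed
  define G where "G = enn2real (g \<zeta>0)"
  have G: "g \<zeta>0 = ennreal G" "0 < G"
    using finite pos[of \<zeta>0] by (auto simp: G_def enn2real_positive_iff less_top zero_less_iff_neq_zero)
  have "\<zeta>0 + max 0 (ln G) \<in> A"
  proof -
    have "g (\<zeta>0 + max 0 (ln G)) \<le> ennreal (exp (- max 0 (ln G))) * ennreal G"
      using contract[of \<zeta>0 "\<zeta>0 + max 0 (ln G)"] G by simp
    also have "\<dots> \<le> ennreal (exp (- ln G) * G)"
      using G(2) by (subst ennreal_mult[symmetric]) (auto intro!: ennreal_leI mult_right_mono)
    also have "\<dots> = 1" using G(2) by (simp add: exp_minus)
    finally show ?thesis by (simp add: A_def)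
  qed
  then have A_ne: "A \<noteq> {}" by auto
  have "min \<zeta>0 (\<zeta>0 + ln G) \<le> \<alpha>" if "\<alpha> \<in> A" for \<alpha>
  proof (cases "\<zeta>0 \<le> \<alpha>")
    case False
    have "ennreal G \<le> ennreal (exp (\<alpha> - \<zeta>0)) * g \<alpha>" using contract[of \<alpha> \<zeta>0] False G by simp
    also have "\<dots> \<le> ennreal (exp (\<alpha> - \<zeta>0)) * 1" using that by (intro mult_mono) (auto simp: A_def)
    finally have "G \<le> exp (\<alpha> - \<zeta>0)" by simp
    then have "ln G \<le> \<alpha> - \<zeta>0" using G(2) ln_le_cancel_iff[of G "exp (\<alpha> - \<zeta>0)"] by simp
    then show ?thesis by simp
  qed simp
  then have A_bdd: "bdd_below A" by (rule bdd_belowI)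
  define \<psi> where "\<psi> = Inf A"
  have above: "\<beta> \<in> A" if "\<psi> < \<beta>" for \<beta>
    using cInf_lessD[OF A_ne] that A_up less_imp_le unfolding \<psi>_def by blast
  have below: "1 < g \<beta>" if "\<beta> < \<psi>" for \<beta>
  proof -
    have "\<beta> \<notin> A" using cInf_lower[OF _ A_bdd, of \<beta>] that unfolding \<psi>_def by (meson leD)
    then show ?thesis by (simp add: A_def not_le)
  qed
  have conv: "(\<lambda>i. ennreal (exp (f \<omega> - N \<omega> * (\<psi> + c / Suc i)))) \<longlonglongrightarrow> ennreal (exp (f \<omega> - N \<omega> * \<psi>))" for \<omega> c
  proof -
    have "(\<lambda>i. c / Suc i) \<longlonglongrightarrow> 0"
      using tendsto_mult[OF tendsto_const[of c] LIMSEQ_inverse_real_of_nat] by (simp add: divide_inverse)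
    then have "(\<lambda>i. exp (f \<omega> - N \<omega> * (\<psi> + c / Suc i))) \<longlonglongrightarrow> exp (f \<omega> - N \<omega> * (\<psi> + 0))"
      by (intro tendsto_intros)
    then show ?thesis by (simp add: tendsto_ennrealI)
  qed
  \<comment> \<open>Fatou from the right gives \<open>g \<psi> \<le> 1\<close>.\<close>
  have le: "g \<psi> \<le> 1"
  proof -
    have "g \<psi> = (\<integral>\<^sup>+\<omega>. liminf (\<lambda>i. ennreal (exp (f \<omega> - N \<omega> * (\<psi> + 1 / Suc i)))) \<partial>M)"
      unfolding g_def using lim_imp_Liminf[OF sequentially_bot conv[of _ 1]] by simp
    also have "\<dots> \<le> liminf (\<lambda>i. g (\<psi> + 1 / Suc i))"
      unfolding g_def by (rule nn_integral_liminf) simp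
    also have "\<dots> \<le> limsup (\<lambda>i. g (\<psi> + 1 / Suc i))" by (rule Liminf_le_Limsup) simp
    also have "\<dots> \<le> 1"
    proof (rule Limsup_bounded, rule always_eventually, rule allI)
      show "g (\<psi> + 1 / Suc i) \<le> 1" for i
        using above[of "\<psi> + 1 / Suc i"] by (simp add: A_def del: of_nat_Suc)
    qed
    finally show ?thesis .
  qed
  \<comment> \<open>Openness provides an integrable dominating function on the left, hence \<open>g \<psi> \<ge> 1\<close>.\<close>
  have ge: "1 \<le> g \<psi>"
  proof -
    have "\<psi> \<in> {\<zeta>. g \<zeta> < \<infinity>}" using le by (auto intro: le_less_trans)
    with "open" obtain e where e: "e > 0" "cball \<psi> e \<subseteq> {\<zeta>. g \<zeta> < \<infinity>}"
      unfolding open_contains_cball by blast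
    have "\<psi> - e \<in> cball \<psi> e" using e(1) by (simp add: dist_real_def)
    with e(2) have dom: "g (\<psi> - e) < \<infinity>" by blast
    have "(\<lambda>i. g (\<psi> + (- e) / Suc i)) \<longlonglongrightarrow> g \<psi>"
      unfolding g_def
    proof (rule nn_integral_dominated_convergence[where w="\<lambda>\<omega>. ennreal (exp (f \<omega> - N \<omega> * (\<psi> - e)))"])
      fix i
      have "exp (f \<omega> - N \<omega> * (\<psi> + (- e) / Suc i)) \<le> exp (f \<omega> - N \<omega> * (\<psi> - e))" if "1 \<le> N \<omega>" for \<omega>
      proof -
        have "e / Suc i \<le> e / 1" using e(1) by (intro divide_left_mono) auto
        then have "N \<omega> * (\<psi> - e) \<le> N \<omega> * (\<psi> + (- e) / Suc i)"
          using that by (intro mult_left_mono) auto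
        then show ?thesis by simp
      qed
      then show "AE \<omega> in M. ennreal (exp (f \<omega> - N \<omega> * (\<psi> + (- e) / Suc i)))
          \<le> ennreal (exp (f \<omega> - N \<omega> * (\<psi> - e)))"
        using N by (auto simp: ennreal_leI elim!: eventually_mono)
    next
      show "AE \<omega> in M. (\<lambda>i. ennreal (exp (f \<omega> - N \<omega> * (\<psi> + (- e) / Suc i))))
          \<longlonglongrightarrow> ennreal (exp (f \<omega> - N \<omega> * \<psi>))"
        by (rule AE_I2) (rule conv)
      show "(\<integral>\<^sup>+\<omega>. ennreal (exp (f \<omega> - N \<omega> * (\<psi> - e))) \<partial>M) < \<infinity>"
        using dom by (simp only: g_def)
    qed simp_all
    then show ?thesis
    proof (rule tendsto_lowerbound)
      have "1 \<le> g (\<psi> + (- e) / Suc i)" for i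
        by (rule less_imp_le, rule below) (use e(1) in \<open>simp del: of_nat_Suc\<close>)
      then show "\<forall>\<^sub>F i in sequentially. 1 \<le> g (\<psi> + (- e) / Suc i)" by (simp only: eventually_True)
    qed simp
  qed
  show ?thesis
  proof (rule ex1I)
    show "g \<psi> = 1" using le ge by simp
    have strict: False if "\<alpha> < \<beta>" "g \<alpha> = 1" "g \<beta> = 1" for \<alpha> \<beta>
      using contract[of \<alpha> \<beta>] that by simp
    show "\<zeta> = \<psi>" if "g \<zeta> = 1" for \<zeta>
      using strict[of \<zeta> \<psi>] strict[of \<psi> \<zeta>] that \<open>g \<psi> = 1\<close> by (meson linorder_neqE)
  qed
qed

section \<open>Martingales with values in the extended half-line\<close>

text \<open>A process in \<open>[0, \<infinity>]\<close> with finite means is almost surely finite, so \<open>enn2real\<close> changes it only on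
  null sets and the martingale identity carries over.\<close>

lemma martingale_enn2real:
  fixes V :: "nat \<Rightarrow> 'a \<Rightarrow> ennreal"
  assumes "finite_measure M" and filt: "filtration (space M) F" and sub: "\<And>n. subalgebra M (F n)"
    and V: "\<And>n. V n \<in> borel_measurable (F n)"
    and fin: "\<And>n. (\<integral>\<^sup>+\<omega>. V n \<omega> \<partial>M) < \<infinity>"
    and mean: "\<And>m n D. m \<le> n \<Longrightarrow> D \<in> sets (F m) \<Longrightarrow> (\<integral>\<^sup>+\<omega>\<in>D. V n \<omega> \<partial>M) = (\<integral>\<^sup>+\<omega>\<in>D. V m \<omega> \<partial>M)"
    and Z: "\<And>n \<omega>. \<omega> \<in> space M \<Longrightarrow> Z n \<omega> = enn2real (V n \<omega>)"
  shows "martingale M F Z"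
proof -
  have VM [measurable]: "V n \<in> borel_measurable M" for n
    by (rule measurable_from_subalg[OF sub V])
  have Z_F: "Z n \<in> borel_measurable (F n)" for n
  proof -
    note [measurable] = V
    have "(\<lambda>\<omega>. enn2real (V n \<omega>)) \<in> borel_measurable (F n)" by measurable
    moreover have "space (F n) = space M" using sub by (simp add: subalgebra_def)
    ultimately show ?thesis using Z by (subst measurable_cong) auto
  qed
  have Z_M [measurable]: "Z n \<in> borel_measurable M" for n
    by (rule measurable_from_subalg[OF sub Z_F])
  have V_fin: "AE \<omega> in M. V n \<omega> \<noteq> \<infinity>" for n
    using fin[of n] by (intro nn_integral_PInf_AE) auto
  have ZV: "AE \<omega> in M. ennreal (Z n \<omega>) = V n \<omega>" for n
    using V_fin[of n] AE_space by eventually_elim (simp add: Z less_top)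
  have int: "integrable M (Z n)" for n
  proof (rule integrableI_nonneg)
    show "AE \<omega> in M. 0 \<le> Z n \<omega>" using AE_space by eventually_elim (simp add: Z)
    have "(\<integral>\<^sup>+\<omega>. ennreal (Z n \<omega>) \<partial>M) = (\<integral>\<^sup>+\<omega>. V n \<omega> \<partial>M)" using ZV by (rule nn_integral_cong_AE)
    then show "(\<integral>\<^sup>+\<omega>. ennreal (Z n \<omega>) \<partial>M) < \<infinity>" using fin by simp
  qed simp
  have set_int: "(\<integral>\<omega>\<in>D. Z n \<omega> \<partial>M) = enn2real (\<integral>\<^sup>+\<omega>\<in>D. V n \<omega> \<partial>M)" if [measurable]: "D \<in> sets M" for D n
  proof -
    have "(\<integral>\<omega>\<in>D. Z n \<omega> \<partial>M) = enn2real (\<integral>\<^sup>+\<omega>. ennreal (indicator D \<omega> *\<^sub>R Z n \<omega>) \<partial>M)"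
      unfolding set_lebesgue_integral_def
      using AE_space by (intro integral_eq_nn_integral) (auto simp: Z)
    also have "(\<integral>\<^sup>+\<omega>. ennreal (indicator D \<omega> *\<^sub>R Z n \<omega>) \<partial>M) = (\<integral>\<^sup>+\<omega>\<in>D. V n \<omega> \<partial>M)"
      using ZV[of n] by (intro nn_integral_cong_AE) (auto simp: indicator_def elim!: eventually_mono)
    finally show ?thesis .
  qed
  have "AE \<omega> in M. real_cond_exp M (F m) (Z n) \<omega> = Z m \<omega>" if "m \<le> n" for m n
  proof -
    interpret finite_measure M by fact
    interpret finite_measure_subalgebra M "F m" by unfold_locales (rule sub)
    show ?thesis
    proof (rule real_cond_exp_charact[OF _ int int Z_F])
      fix D assume D: "D \<in> sets (F m)"
      then have "D \<in> sets M" using subalg by (auto simp: subalgebra_def)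
      then show "(\<integral>\<omega>\<in>D. Z n \<omega> \<partial>M) = (\<integral>\<omega>\<in>D. Z m \<omega> \<partial>M)"
        by (simp add: set_int mean[OF that D])
    qed
  qed
  then show ?thesis
    unfolding martingale_def using filt sub Z_F int by blast
qed

section \<open>The filtrations of the chain\<close>

lemma space_map_filtration [simp]: "space (map_filtration W \<X> X S n) = space W"
  by (simp add: map_filtration_def space_measure_of_conv)

lemma space_regen_filtration [simp]: "space (regen_filtration W \<X> X S Y n) = space W"
  by (simp add: regen_filtration_def space_measure_of_conv)

lemma sets_map_filtration:
  "sets (map_filtration W \<X> X S n) = sigma_sets (space W)
     ((\<Union>i\<in>{0..n}. {X i -` A \<inter> space W | A. A \<in> sets \<X>}) \<union>
      (\<Union>i\<in>{1..n}. {incr S i -` B \<inter> space W | B. B \<in> sets borel}))"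
  unfolding map_filtration_def by (rule sets_measure_of) auto

lemma sets_regen_filtration:
  "sets (regen_filtration W \<X> X S Y n) = sigma_sets (space W)
     (sets (map_filtration W \<X> X S n) \<union>
      (\<Union>k\<in>{1..}.
         {(\<lambda>\<omega>. if regen_time Y k \<omega> \<le> enat n then the_enat (regen_time Y k \<omega>) else 0) -` B
            \<inter> space W | B :: nat set. True}))"
  unfolding regen_filtration_def
  using sets.sets_into_space[of _ "map_filtration W \<X> X S n"]
  by (intro sets_measure_of) (auto simp: Pow_def)

lemma subalgebra_map_regen_filtration:
  "subalgebra (regen_filtration W \<X> X S Y n) (map_filtration W \<X> X S n)"
  unfolding subalgebra_def by (auto simp: sets_regen_filtration)

lemma measurable_capped_regen_time:
  assumes "1 \<le> k"
  shows "(\<lambda>\<omega>. if regen_time Y k \<omega> \<le> enat n then the_enat (regen_time Y k \<omega>) else 0)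
    \<in> regen_filtration W \<X> X S Y n \<rightarrow>\<^sub>M count_space UNIV"
proof (rule measurableI)
  fix B :: "nat set"
  show "(\<lambda>\<omega>. if regen_time Y k \<omega> \<le> enat n then the_enat (regen_time Y k \<omega>) else 0) -` B
      \<inter> space (regen_filtration W \<X> X S Y n) \<in> sets (regen_filtration W \<X> X S Y n)"
    unfolding sets_regen_filtration space_regen_filtration using assms
    by (intro sigma_sets.Basic UnI2 UN_I[of k]) auto
qed simp

text \<open>The filtration is generated by the capped times \<open>\<tau>(k) 1{\<tau>(k) \<le> n}\<close>, with \<open>0\<close> as the value for
  times beyond \<open>n\<close>; hence the restriction to \<open>i \<ge> 1\<close>.\<close>

lemma measurable_regeneration_event:
  assumes "1 \<le> i" "i \<le> n"
  shows "Measurable.pred (regen_filtration W \<X> X S Y n) (Y i)"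
proof -
  let ?c = "\<lambda>k \<omega>. if regen_time Y k \<omega> \<le> enat n then the_enat (regen_time Y k \<omega>) else 0"
  have "Y i \<omega> \<longleftrightarrow> (\<exists>k\<in>{1..}. ?c k \<omega> = i)" for \<omega>
  proof -
    have "?c k \<omega> = i \<longleftrightarrow> regen_time Y k \<omega> = enat i" for k
      using assms by (cases "regen_time Y k \<omega>") auto
    then show ?thesis using ex_regen_time_eq_iff[of Y \<omega> i] assms(1) by auto
  qed
  then have "Y i = (\<lambda>\<omega>. \<exists>k\<in>{1..}. ?c k \<omega> = i)" by (rule ext)
  moreover have "Measurable.pred (regen_filtration W \<X> X S Y n) (\<lambda>\<omega>. ?c k \<omega> = i)" if "k \<in> {1..}" for k
    using measurable_capped_regen_time[of k Y n W \<X> X S] that by (intro pred_eq_const1) auto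
  ultimately show ?thesis
    by (auto intro!: pred_intros_countable_bounded)
qed

context split_chain
begin

abbreviation \<F> :: "nat \<Rightarrow> 'w measure" where "\<F> \<equiv> map_filtration W \<X> X S"
abbreviation \<G> :: "nat \<Rightarrow> 'w measure" where "\<G> \<equiv> regen_filtration W \<X> X S Y"
abbreviation \<xi> :: "nat \<Rightarrow> 'w \<Rightarrow> 'v" where "\<xi> \<equiv> incr S"

lemma measurable_from_F:
  assumes "f \<in> \<F> n \<rightarrow>\<^sub>M N" shows "f \<in> \<G> n \<rightarrow>\<^sub>M N"
  by (rule measurable_from_subalg[OF subalgebra_map_regen_filtration assms])

lemma X_measurable_G: assumes "i \<le> n" shows "X i \<in> \<G> n \<rightarrow>\<^sub>M \<X>"
proof (rule measurable_from_F, rule measurableI)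
  show "X i \<omega> \<in> space \<X>" if "\<omega> \<in> space (\<F> n)" for \<omega>
    using measurable_space[OF X_measurable] that by simp
  show "X i -` A \<inter> space (\<F> n) \<in> sets (\<F> n)" if "A \<in> sets \<X>" for A
    unfolding sets_map_filtration space_map_filtration using assms that
    by (intro sigma_sets.Basic UnI1 UN_I[of i]) auto
qed

lemma incr_measurable_G:
  assumes "1 \<le> i" "i \<le> n" shows "\<xi> i \<in> borel_measurable (\<G> n)"
proof (rule measurable_from_F, rule measurableI)
  show "\<xi> i -` A \<inter> space (\<F> n) \<in> sets (\<F> n)" if "A \<in> sets borel" for A
    unfolding sets_map_filtration space_map_filtration using assms that
    by (intro sigma_sets.Basic UnI2 UN_I[of i]) auto
qed simp

lemma S_measurable_G: "i \<le> n \<Longrightarrow> S i \<in> borel_measurable (\<G> n)"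
proof (induction i)
  case 0
  have "(\<lambda>\<omega>. 0 :: 'v) \<in> borel_measurable (\<G> n)" by simp
  then show ?case by (rule measurable_cong[THEN iffD1, rotated]) (simp add: S_0)
next
  case (Suc i)
  then have [measurable]: "S i \<in> borel_measurable (\<G> n)" "\<xi> (Suc i) \<in> borel_measurable (\<G> n)"
    by (auto intro: incr_measurable_G)
  have "S (Suc i) = (\<lambda>\<omega>. S i \<omega> + \<xi> (Suc i) \<omega>)" by (auto simp: incr_def)
  then show ?case by simp
qed

lemma incr_measurable [measurable]: "\<xi> i \<in> borel_measurable W"
proof -
  note S_measurable [measurable]
  show ?thesis unfolding incr_def[abs_def] by measurable
qed

lemma regen_time_eq_measurable: "Measurable.pred W (\<lambda>\<omega>. regen_time Y k \<omega> = enat n)"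
proof (induction k arbitrary: n)
  case 0
  then show ?case by simp
next
  case (Suc k)
  note [measurable] = Y_measurable
  have less: "regen_time Y k \<omega> < enat j \<longleftrightarrow> (\<exists>i\<in>{..<j}. regen_time Y k \<omega> = enat i)" for j \<omega>
    by (cases "regen_time Y k \<omega>") auto
  have [measurable]: "Measurable.pred W (\<lambda>\<omega>. regen_time Y k \<omega> < enat j)" for j
    unfolding less using Suc by (intro pred_intros_finite) auto
  have "Measurable.pred W (\<lambda>\<omega>. regen_time Y k \<omega> < enat n \<and> Y n \<omega> \<and>
      (\<forall>j\<in>{..<n}. \<not> (regen_time Y k \<omega> < enat j \<and> Y j \<omega>)))"
    by measurable
  then show ?case by (simp only: regen_time_Suc_eq_enat_iff Ball_def lessThan_iff)
qed

lemma subalgebra_G: "subalgebra W (\<G> n)"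
proof -
  note [measurable] = X_measurable regen_time_eq_measurable
  have F: "sets (\<F> n) \<subseteq> sets W"
    unfolding sets_map_filtration by (intro sets.sigma_sets_subset) auto
  have c: "(\<lambda>\<omega>. if regen_time Y k \<omega> \<le> enat n then the_enat (regen_time Y k \<omega>) else 0) -` B
      \<inter> space W \<in> sets W" for k B
  proof -
    have "(if regen_time Y k \<omega> \<le> enat n then the_enat (regen_time Y k \<omega>) else 0) \<in> B \<longleftrightarrow>
        (\<exists>i\<in>{..n}. regen_time Y k \<omega> = enat i \<and> i \<in> B) \<or>
        ((\<forall>i\<in>{..n}. regen_time Y k \<omega> \<noteq> enat i) \<and> 0 \<in> B)" for \<omega>
      by (cases "regen_time Y k \<omega>") auto
    then have "(\<lambda>\<omega>. if regen_time Y k \<omega> \<le> enat n then the_enat (regen_time Y k \<omega>) else 0) -` B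
        \<inter> space W =
      {\<omega> \<in> space W. (\<exists>i\<in>{..n}. regen_time Y k \<omega> = enat i \<and> i \<in> B) \<or>
        ((\<forall>i\<in>{..n}. regen_time Y k \<omega> \<noteq> enat i) \<and> 0 \<in> B)}"
      by (auto simp del: if_split)
    then show ?thesis by simp
  qed
  have "sets (\<G> n) \<subseteq> sets W"
    unfolding sets_regen_filtration using F c by (intro sets.sigma_sets_subset) auto
  then show ?thesis by (simp add: subalgebra_def)
qed

text \<open>The cap at \<open>m\<close> is a function of the cap at any later \<open>n\<close>.\<close>

lemma sets_G_mono: assumes "m \<le> n" shows "sets (\<G> m) \<subseteq> sets (\<G> n)"
proof -
  let ?c = "\<lambda>n k \<omega>. if regen_time Y k \<omega> \<le> enat n then the_enat (regen_time Y k \<omega>) else 0"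
  have "sets (\<F> m) \<subseteq> sets (\<F> n)"
    unfolding sets_map_filtration using assms
    by (intro sigma_sets_mono' Un_mono UN_mono) auto
  then have F: "sets (\<F> m) \<subseteq> sets (\<G> n)"
    using subalgebra_map_regen_filtration[of W \<X> X S Y n] by (auto simp: subalgebra_def)
  have c: "?c m k -` B \<inter> space W \<in> sets (\<G> n)" if "1 \<le> k" for k B
  proof -
    have "?c m k = (\<lambda>v. if v \<le> m then v else 0) \<circ> ?c n k"
    proof
      show "?c m k \<omega> = ((\<lambda>v. if v \<le> m then v else 0) \<circ> ?c n k) \<omega>" for \<omega>
        using assms by (cases "regen_time Y k \<omega>") auto
    qed
    moreover have "(\<lambda>v. if v \<le> m then v else 0) \<circ> ?c n k \<in> \<G> n \<rightarrow>\<^sub>M count_space UNIV"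
      by (rule measurable_comp[OF measurable_capped_regen_time[OF that]]) simp
    ultimately have "?c m k \<in> \<G> n \<rightarrow>\<^sub>M count_space UNIV" by simp
    from measurable_sets[OF this, of B] show ?thesis by simp
  qed
  show ?thesis
    unfolding sets_regen_filtration[of _ _ _ _ _ m] 
    using F c by (subst space_regen_filtration[of W \<X> X S Y n, symmetric], intro sets.sigma_sets_subset) auto
qed

lemma filtration_G: "filtration (space W) \<G>"
  by standard (simp_all add: sets_G_mono)

lemma stopping_time_less_measurable:
  assumes "extended_stopping_time W \<F> T" "u \<le> Suc n"
  shows "Measurable.pred (\<G> n) (\<lambda>\<omega>. T \<omega> < enat u)"
proof (cases u)
  case 0
  then show ?thesis by (simp flip: zero_enat_def)
next
  case (Suc v)
  have "{\<omega> \<in> space W. T \<omega> \<le> enat v} \<in> sets (\<G> v)"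
    using assms(1) subalgebra_map_regen_filtration[of W \<X> X S Y v]
    by (auto simp: extended_stopping_time_def subalgebra_def)
  also have "sets (\<G> v) \<subseteq> sets (\<G> n)" using assms(2) Suc by (intro sets_G_mono) simp
  finally have "{\<omega> \<in> space W. T \<omega> \<le> enat v} \<in> sets (\<G> n)" .
  moreover have "T \<omega> < enat u \<longleftrightarrow> T \<omega> \<le> enat v" for \<omega>
    unfolding Suc by (cases "T \<omega>") auto
  ultimately show ?thesis by (simp add: pred_def)
qed

lemma next_regen_eq_measurable:
  assumes "extended_stopping_time W \<F> T" "u \<le> n"
  shows "Measurable.pred (\<G> n) (\<lambda>\<omega>. next_regen Y T \<omega> = enat u)"
proof -
  define Q where "Q j \<omega> \<longleftrightarrow> T \<omega> < enat j \<and> Y j \<omega>" for j \<omega>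
  have Q: "Measurable.pred (\<G> n) (Q j)" if "j \<le> n" for j
  proof (cases j)
    case 0
    then show ?thesis by (simp add: Q_def[abs_def] flip: zero_enat_def)
  next
    case (Suc i)
    then show ?thesis using that assms(1) unfolding Q_def[abs_def]
      by (intro pred_intros_logic stopping_time_less_measurable measurable_regeneration_event) auto
  qed
  have "Measurable.pred (\<G> n) (\<lambda>\<omega>. Q u \<omega> \<and> (\<forall>j\<in>{..<u}. \<not> Q j \<omega>))"
    using assms(2) by (intro pred_intros_logic pred_intros_finite) (auto intro!: Q)
  then show ?thesis
    by (simp add: next_regen_eq_enat_iff Q_def lessThan_iff Ball_def conj_assoc)
qed

end

section \<open>The Markov property of the split chain\<close>

lemma emeasure_distr_density_indicator:
  assumes [measurable]: "k \<in> M \<rightarrow>\<^sub>M N" "R \<in> sets M" "E \<in> sets N"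
  shows "emeasure (distr (density M (indicator R)) N k) E = emeasure M {\<omega> \<in> R. k \<omega> \<in> E}"
proof -
  have "emeasure (distr (density M (indicator R)) N k) E = emeasure M (R \<inter> (k -` E \<inter> space M))"
    by (simp add: emeasure_distr emeasure_density flip: indicator_inter_arith)
  also have "R \<inter> (k -` E \<inter> space M) = {\<omega> \<in> R. k \<omega> \<in> E}"
    using sets.sets_into_space[OF assms(2)] by auto
  finally show ?thesis .
qed

lemma nn_integral_distr_density_indicator:
  assumes [measurable]: "k \<in> M \<rightarrow>\<^sub>M N" "R \<in> sets M" "f \<in> borel_measurable N"
  shows "(\<integral>\<^sup>+z. f z \<partial>distr (density M (indicator R)) N k) = (\<integral>\<^sup>+\<omega>\<in>R. f (k \<omega>) \<partial>M)"
  by (simp add: nn_integral_distr nn_integral_density mult.commute)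

context split_chain
begin

lemma law_cong:
  assumes "\<mu> \<in> space (prob_algebra \<X>)"
  shows "prob_space (Pr \<mu>)" "sets (Pr \<mu>) = sets W" "space (Pr \<mu>) = space W"
  using law[OF assms] by (auto simp: space_prob_algebra dest: sets_eq_imp_space_eq)

lemma return_prob_algebra: "x \<in> space \<X> \<Longrightarrow> return \<X> x \<in> space (prob_algebra \<X>)"
  by (simp add: space_prob_algebra prob_space_return)

lemma subalgebra_law:
  assumes "\<mu> \<in> space (prob_algebra \<X>)" shows "subalgebra (Pr \<mu>) (\<G> n)"
  using subalgebra_G[of n] law_cong[OF assms] by (simp add: subalgebra_def)

definition split_rate :: "bool \<Rightarrow> 'x set \<Rightarrow> 'v set \<Rightarrow> 'x \<Rightarrow> real" where
  "split_rate b A B x =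
     (if b then measure \<nu> A * measure (h x) B
      else measure (P x) (A \<times> B) - measure \<nu> A * measure (h x) B)"

lemma split_rate_nonneg:
  assumes "x \<in> space \<X>" "A \<in> sets \<X>" "B \<in> sets borel"
  shows "0 \<le> split_rate b A B x"
proof -
  interpret P: prob_space "P x"
    using measurable_space[OF kernel assms(1)] by (simp add: space_prob_algebra)
  interpret h: subprob_space "h x"
    using measurable_space[OF h_kernel assms(1)] by (simp add: space_subprob_algebra)
  interpret \<nu>: prob_space \<nu> using nu by (simp add: space_prob_algebra)
  have "measure (h x) B * measure \<nu> A \<le> measure (P x) (A \<times> B)"
    using minorization[OF assms]
    by (simp add: P.emeasure_eq_measure h.emeasure_eq_measure \<nu>.emeasure_eq_measure flip: ennreal_mult)
  then show ?thesis by (simp add: split_rate_def mult.commute)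
qed

lemma split_rate_measurable:
  assumes [measurable]: "A \<in> sets \<X>" "B \<in> sets borel"
  shows "split_rate b A B \<in> borel_measurable \<X>"
proof -
  have [measurable]: "(\<lambda>x. emeasure (h x) B) \<in> borel_measurable \<X>"
    "(\<lambda>x. emeasure (P x) (A \<times> B)) \<in> borel_measurable \<X>"
    using measurable_emeasure_kernel[OF h_kernel] measurable_emeasure_kernel[OF measurable_prob_algebraD[OF kernel]]
    by auto
  show ?thesis unfolding split_rate_def[abs_def] measure_def by measurable
qed

text \<open>Both defining properties of the split chain in one integrated form, without conditional
  expectations.\<close>

lemma emeasure_split_step:
  assumes \<mu>: "\<mu> \<in> space (prob_algebra \<X>)"
    and A [measurable]: "A \<in> sets \<X>" and B [measurable]: "B \<in> sets borel"
    and D: "D \<in> sets (\<G> n)"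
  shows "emeasure (Pr \<mu>) {\<omega> \<in> D. Y (Suc n) \<omega> = b \<and> X (Suc n) \<omega> \<in> A \<and> \<xi> (Suc n) \<omega> \<in> B} =
    (\<integral>\<^sup>+\<omega>. ennreal (split_rate b A B (X n \<omega>)) * indicator D \<omega> \<partial>Pr \<mu>)"
proof -
  note [measurable] = X_measurable Y_measurable split_rate_measurable[OF A B]
  note [measurable_cong] = law_cong(2)[OF \<mu>]
  note [simp] = law_cong(3)[OF \<mu>]
  interpret prob_space "Pr \<mu>" by (rule law_cong(1)[OF \<mu>])
  interpret finite_measure_subalgebra "Pr \<mu>" "\<G> n"
    by unfold_locales (rule subalgebra_law[OF \<mu>])
  have D' [measurable]: "D \<in> sets (Pr \<mu>)" using subalg D by (auto simp: subalgebra_def)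
  define E where "E = {\<omega> \<in> space W. Y (Suc n) \<omega> = b \<and> X (Suc n) \<omega> \<in> A \<and> \<xi> (Suc n) \<omega> \<in> B}"
  have E [measurable]: "E \<in> sets (Pr \<mu>)" unfolding E_def by measurable
  have int_E: "integrable (Pr \<mu>) (indicator E :: 'w \<Rightarrow> real)"
    by (rule integrable_real_indicator) (auto simp: emeasure_eq_measure)
  let ?c = "real_cond_exp (Pr \<mu>) (\<G> n) (indicator E)"
  have AE: "AE \<omega> in Pr \<mu>. ?c \<omega> = split_rate b A B (X n \<omega>)"
    using regeneration[OF \<mu> A B, of n] residual[OF \<mu> A B, of n]
    by (cases b) (simp_all add: E_def split_rate_def)
  have "integrable (Pr \<mu>) ?c"
    by (rule real_cond_exp_int[OF int_E])
  then have int: "integrable (Pr \<mu>) (\<lambda>\<omega>. split_rate b A B (X n \<omega>))"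
    using AE by (subst (asm) integrable_cong_AE) auto
  have nn: "0 \<le> split_rate b A B (X n \<omega>)" if "\<omega> \<in> space W" for \<omega>
    using split_rate_nonneg[OF _ A B] measurable_space[OF X_measurable that] by blast
  have "measure (Pr \<mu>) (D \<inter> E) = (\<integral>\<omega>\<in>D. indicator E \<omega> \<partial>Pr \<mu>)"
    unfolding set_lebesgue_integral_def
    using D' E sets.sets_into_space[OF D'] by (simp flip: indicator_inter_arith add: Int_absorb2 le_infI1)
  also have "\<dots> = (\<integral>\<omega>\<in>D. ?c \<omega> \<partial>Pr \<mu>)"
    by (rule real_cond_exp_intA[OF int_E D])
  also have "\<dots> = (\<integral>\<omega>. split_rate b A B (X n \<omega>) * indicator D \<omega> \<partial>Pr \<mu>)"
    unfolding set_lebesgue_integral_def using AE by (intro integral_cong_AE) (auto simp: mult.commute)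
  finally have "ennreal (measure (Pr \<mu>) (D \<inter> E)) =
      (\<integral>\<^sup>+\<omega>. ennreal (split_rate b A B (X n \<omega>) * indicator D \<omega>) \<partial>Pr \<mu>)"
    using nn by (subst nn_integral_eq_integral)
      (auto intro!: integrable_real_mult_indicator int AE_I2 mult_nonneg_nonneg)
  also have "\<dots> = (\<integral>\<^sup>+\<omega>. ennreal (split_rate b A B (X n \<omega>)) * indicator D \<omega> \<partial>Pr \<mu>)"
    by (intro nn_integral_cong) (auto simp: indicator_def)
  also have "D \<inter> E = {\<omega> \<in> D. Y (Suc n) \<omega> = b \<and> X (Suc n) \<omega> \<in> A \<and> \<xi> (Suc n) \<omega> \<in> B}"
    using sets.sets_into_space[OF D'] by (auto simp: E_def)
  finally show ?thesis by (simp add: emeasure_eq_measure)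
qed

text \<open>The subprobability kernel of one step that regenerates (\<open>b = True\<close>) or does not
  (\<open>b = False\<close>). For \<open>b = False\<close> it is the residual measure \<open>P x - \<nu> \<times> h x\<close>. The minorization is
  assumed on rectangles only; reading the kernel off the law of the first step, instead of subtracting
  measures, gives a measure on the product space without any extension argument.\<close>

definition split_kernel :: "bool \<Rightarrow> 'x \<Rightarrow> ('x \<times> 'v) measure" where
  "split_kernel b x =
     distr (density (Pr (return \<X> x)) (indicator {\<omega> \<in> space W. Y 1 \<omega> = b})) (\<X> \<Otimes>\<^sub>M borel)
       (\<lambda>\<omega>. (X 1 \<omega>, \<xi> 1 \<omega>))"

lemma sets_split_kernel [simp, measurable_cong]: "sets (split_kernel b x) = sets (\<X> \<Otimes>\<^sub>M borel)"
  by (simp add: split_kernel_def)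

lemma emeasure_split_kernel:
  assumes x: "x \<in> space \<X>" and A [measurable]: "A \<in> sets \<X>" and B [measurable]: "B \<in> sets borel"
  shows "emeasure (split_kernel b x) (A \<times> B) = ennreal (split_rate b A B x)"
proof -
  note \<mu> = return_prob_algebra[OF x]
  note [measurable] = X_measurable Y_measurable split_rate_measurable[OF A B]
  note [measurable_cong] = law_cong(2)[OF \<mu>]
  note [simp] = law_cong(3)[OF \<mu>]
  have "emeasure (split_kernel b x) (A \<times> B) =
      emeasure (Pr (return \<X> x)) {\<omega> \<in> space W. Y (Suc 0) \<omega> = b \<and> X (Suc 0) \<omega> \<in> A \<and> \<xi> (Suc 0) \<omega> \<in> B}"
    unfolding split_kernel_def One_nat_def
    by (subst emeasure_distr_density_indicator) (auto intro!: arg_cong2[where f=emeasure])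
  also have "\<dots> = (\<integral>\<^sup>+\<omega>. ennreal (split_rate b A B (X 0 \<omega>)) * indicator (space W) \<omega> \<partial>Pr (return \<X> x))"
    by (rule emeasure_split_step[OF \<mu> A B]) (metis sets.top space_regen_filtration)
  also have "\<dots> = (\<integral>\<^sup>+\<omega>. ennreal (split_rate b A B (X 0 \<omega>)) \<partial>Pr (return \<X> x))"
    by (intro nn_integral_cong) simp
  also have "\<dots> = (\<integral>\<^sup>+y. ennreal (split_rate b A B y) \<partial>distr (Pr (return \<X> x)) \<X> (X 0))"
    by (subst nn_integral_distr) auto
  also have "\<dots> = ennreal (split_rate b A B x)"
    unfolding initial[OF \<mu>] using x by (subst nn_integral_return) auto
  finally show ?thesis .
qed

lemma split_kernel_measurable [measurable]:
  "split_kernel b \<in> \<X> \<rightarrow>\<^sub>M subprob_algebra (\<X> \<Otimes>\<^sub>M borel)"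
proof (rule measurable_subprob_algebra_generated[OF sets_pair_measure Int_stable_pair_measure_generator
      pair_measure_closed])
  fix x assume x: "x \<in> space \<X>"
  note \<mu> = return_prob_algebra[OF x]
  note [measurable] = X_measurable Y_measurable
  note [measurable_cong] = law_cong(2)[OF \<mu>]
  note [simp] = law_cong(3)[OF \<mu>]
  interpret prob_space "Pr (return \<X> x)" by (rule law_cong(1)[OF \<mu>])
  show "subprob_space (split_kernel b x)"
    unfolding split_kernel_def
  proof (intro subprob_space.subprob_space_distr)
    show "subprob_space (density (Pr (return \<X> x)) (indicator {\<omega> \<in> space W. Y 1 \<omega> = b}))"
    proof
      show "emeasure (density (Pr (return \<X> x)) (indicator {\<omega> \<in> space W. Y 1 \<omega> = b}))
          (space (density (Pr (return \<X> x)) (indicator {\<omega> \<in> space W. Y 1 \<omega> = b}))) \<le> 1"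
        by (subst emeasure_density) (auto simp flip: indicator_inter_arith simp: emeasure_eq_measure)
      show "space (density (Pr (return \<X> x)) (indicator {\<omega> \<in> space W. Y 1 \<omega> = b})) \<noteq> {}"
        using not_empty by simp
    qed
  qed (use x in \<open>auto simp: space_pair_measure\<close>)
  show "sets (split_kernel b x) = sets (\<X> \<Otimes>\<^sub>M borel)" by simp
next
  have *: "(\<lambda>x. emeasure (split_kernel b x) (A \<times> B)) \<in> borel_measurable \<X>"
    if "A \<in> sets \<X>" "B \<in> sets borel" for A B
  proof -
    note [measurable] = split_rate_measurable[OF that]
    have "(\<lambda>x. ennreal (split_rate b A B x)) \<in> borel_measurable \<X>" by measurable
    then show ?thesis
      using emeasure_split_kernel[OF _ that] by (subst measurable_cong) auto
  qed
  show "(\<lambda>x. emeasure (split_kernel b x) G) \<in> borel_measurable \<X>"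
    if "G \<in> {A \<times> B |A B. A \<in> sets \<X> \<and> B \<in> sets borel}" for G
    using that * by auto
  show "(\<lambda>x. emeasure (split_kernel b x) (space \<X> \<times> space borel)) \<in> borel_measurable \<X>"
    by (rule *) (auto simp: space_borel[symmetric] simp del: space_borel)
qed

lemma split_kernel_True:
  assumes x: "x \<in> space \<X>"
  shows "split_kernel True x = \<nu> \<Otimes>\<^sub>M h x"
proof -
  interpret h: subprob_space "h x"
    using measurable_space[OF h_kernel x] by (simp add: space_subprob_algebra)
  interpret \<nu>: prob_space \<nu> using nu by (simp add: space_prob_algebra)
  have s: "sets \<nu> = sets \<X>" "sets (h x) = sets borel"
    using nu measurable_space[OF h_kernel x] by (auto simp: space_subprob_algebra space_prob_algebra)
  show ?thesis
  proof (rule pair_measure_eqI[symmetric])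
    show "sigma_finite_measure \<nu>" "sigma_finite_measure (h x)"
      by (rule \<nu>.sigma_finite_measure_axioms h.sigma_finite_measure_axioms)+
    show "sets (\<nu> \<Otimes>\<^sub>M h x) = sets (split_kernel True x)"
      by (simp add: s cong: sets_pair_measure_cong)
    show "emeasure \<nu> A * emeasure (h x) B = emeasure (split_kernel True x) (A \<times> B)"
      if "A \<in> sets \<nu>" "B \<in> sets (h x)" for A B
      using that x
      by (simp add: s emeasure_split_kernel split_rate_def h.emeasure_eq_measure
          \<nu>.emeasure_eq_measure ennreal_mult)
  qed
qed

text \<open>The hypotheses on the chain concern rectangles \<open>A \<times> B\<close>. For a fixed past event \<open>D\<close> both sides are
  finite measures in the next step, and agree since rectangles form an intersection-stable
  generator; the weight \<open>g\<close> then comes in through conditional expectation.\<close>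

lemma split_markov:
  assumes \<mu>: "\<mu> \<in> space (prob_algebra \<X>)"
    and f [measurable]: "f \<in> borel_measurable (\<X> \<Otimes>\<^sub>M borel)"
    and g: "g \<in> borel_measurable (\<G> n)"
  shows "(\<integral>\<^sup>+\<omega>. g \<omega> * (if Y (Suc n) \<omega> = b then f (X (Suc n) \<omega>, \<xi> (Suc n) \<omega>) else 0) \<partial>Pr \<mu>) =
    (\<integral>\<^sup>+\<omega>. g \<omega> * (\<integral>\<^sup>+z. f z \<partial>split_kernel b (X n \<omega>)) \<partial>Pr \<mu>)"
proof -
  note [measurable] = X_measurable Y_measurable X_measurable_G[OF order_refl]
  note [measurable_cong] = law_cong(2)[OF \<mu>]
  note [simp] = law_cong(3)[OF \<mu>]
  interpret prob_space "Pr \<mu>" by (rule law_cong(1)[OF \<mu>])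
  interpret finite_measure_subalgebra "Pr \<mu>" "\<G> n"
    by unfold_locales (rule subalgebra_law[OF \<mu>])
  let ?f = "\<lambda>\<omega>. if Y (Suc n) \<omega> = b then f (X (Suc n) \<omega>, \<xi> (Suc n) \<omega>) else 0"
  let ?Jf = "\<lambda>\<omega>. \<integral>\<^sup>+z. f z \<partial>split_kernel b (X n \<omega>)"
  have Jf [measurable]: "?Jf \<in> borel_measurable (\<G> n)"
    by (rule nn_integral_measurable_subprob_algebra2[where N="\<X> \<Otimes>\<^sub>M borel"]) measurable
  have "AE \<omega> in Pr \<mu>. ?Jf \<omega> = nn_cond_exp (Pr \<mu>) (\<G> n) ?f \<omega>"
  proof (rule nn_cond_exp_charact)
    fix D assume D: "D \<in> sets (\<G> n)"
    then have [measurable]: "D \<in> sets (Pr \<mu>)" using subalg by (auto simp: subalgebra_def)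
    have D_W: "D \<subseteq> space W" using sets.sets_into_space[OF D] by simp
    define R where "R = {\<omega> \<in> space W. \<omega> \<in> D \<and> Y (Suc n) \<omega> = b}"
    have R [measurable]: "R \<in> sets (Pr \<mu>)" unfolding R_def by measurable
    have step [measurable]: "(\<lambda>\<omega>. (X (Suc n) \<omega>, \<xi> (Suc n) \<omega>)) \<in> Pr \<mu> \<rightarrow>\<^sub>M \<X> \<Otimes>\<^sub>M borel"
      by measurable
    define N1 where "N1 = distr (density (Pr \<mu>) (indicator R)) (\<X> \<Otimes>\<^sub>M borel)
        (\<lambda>\<omega>. (X (Suc n) \<omega>, \<xi> (Suc n) \<omega>))"
    define N2 where "N2 = density (Pr \<mu>) (indicator D) \<bind> (\<lambda>\<omega>. split_kernel b (X n \<omega>))"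
    have J [measurable]: "(\<lambda>\<omega>. split_kernel b (X n \<omega>)) \<in>
        density (Pr \<mu>) (indicator D) \<rightarrow>\<^sub>M subprob_algebra (\<X> \<Otimes>\<^sub>M borel)"
      by measurable
    have ne: "space (density (Pr \<mu>) (indicator D)) \<noteq> {}" using not_empty by simp
    have sets_N1: "sets N1 = sets (\<X> \<Otimes>\<^sub>M borel)" by (simp add: N1_def)
    have sets_N2: "sets N2 = sets (\<X> \<Otimes>\<^sub>M borel)"
      unfolding N2_def using ne by (intro sets_bind) auto
    have eq: "emeasure N1 (A \<times> B) = emeasure N2 (A \<times> B)"
      if A [measurable]: "A \<in> sets \<X>" and B [measurable]: "B \<in> sets borel" for A B
    proof -
      note [measurable] = split_rate_measurable[OF A B]
      have "emeasure N1 (A \<times> B) = emeasure (Pr \<mu>)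
          {\<omega> \<in> D. Y (Suc n) \<omega> = b \<and> X (Suc n) \<omega> \<in> A \<and> \<xi> (Suc n) \<omega> \<in> B}"
        unfolding N1_def
by (subst emeasure_distr_density_indicator[OF step R])
          (use D_W in \<open>auto simp: R_def intro!: arg_cong2[where f=emeasure]\<close>)
      also have "\<dots> = (\<integral>\<^sup>+\<omega>. ennreal (split_rate b A B (X n \<omega>)) * indicator D \<omega> \<partial>Pr \<mu>)"
        by (rule emeasure_split_step[OF \<mu> A B D])
      also have "\<dots> = (\<integral>\<^sup>+\<omega>. emeasure (split_kernel b (X n \<omega>)) (A \<times> B) \<partial>density (Pr \<mu>) (indicator D))"
      proof (subst nn_integral_density)
        have "(\<lambda>\<omega>. split_kernel b (X n \<omega>)) \<in> Pr \<mu> \<rightarrow>\<^sub>M subprob_algebra (\<X> \<Otimes>\<^sub>M borel)"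
          by measurable
        then show "(\<lambda>\<omega>. emeasure (split_kernel b (X n \<omega>)) (A \<times> B)) \<in> borel_measurable (Pr \<mu>)"
          by (rule measurable_emeasure_kernel) simp
      qed (auto simp: emeasure_split_kernel[OF measurable_space[OF X_measurable] A B] mult.commute
          intro!: nn_integral_cong)
      also have "\<dots> = emeasure N2 (A \<times> B)"
        unfolding N2_def by (rule emeasure_bind[OF ne J, symmetric]) simp
      finally show ?thesis .
    qed
    have "N1 = N2"
    proof (rule measure_eqI_generator_eq[OF Int_stable_pair_measure_generator pair_measure_closed])
      show "sets N1 = sigma_sets (space \<X> \<times> space borel) {a \<times> b |a b. a \<in> sets \<X> \<and> b \<in> sets borel}"
        "sets N2 = sigma_sets (space \<X> \<times> space borel) {a \<times> b |a b. a \<in> sets \<X> \<and> b \<in> sets borel}"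
        unfolding sets_N1 sets_N2 by (rule sets_pair_measure)+
      show "emeasure N1 G = emeasure N2 G" if "G \<in> {a \<times> b |a b. a \<in> sets \<X> \<and> b \<in> sets borel}" for G
        using that eq by auto
      show "range (\<lambda>i::nat. space \<X> \<times> space borel) \<subseteq> {a \<times> b |a b. a \<in> sets \<X> \<and> b \<in> sets borel}"
        using sets.top[of \<X>] sets.top[of "borel :: 'v measure"] by blast
      show "(\<Union>i::nat. space \<X> \<times> space borel) = space \<X> \<times> space borel" by simp
      have "emeasure N1 (space \<X> \<times> space borel) \<le> emeasure (Pr \<mu>) (space (Pr \<mu>))"
        unfolding N1_def
        by (subst emeasure_distr_density_indicator[OF step R])
          (auto simp: R_def intro!: emeasure_mono)
      then show "emeasure N1 (space \<X> \<times> space borel) \<noteq> \<infinity>"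
        by (auto simp: emeasure_space_1 top_unique)
    qed
    have "(\<integral>\<^sup>+\<omega>. ?f \<omega> * indicator D \<omega> \<partial>Pr \<mu>) = (\<integral>\<^sup>+z. f z \<partial>N1)"
      unfolding N1_def
      by (subst nn_integral_distr_density_indicator[OF step R f])
        (auto simp: R_def indicator_def intro!: nn_integral_cong)
    also have "\<dots> = (\<integral>\<^sup>+\<omega>. ?Jf \<omega> \<partial>density (Pr \<mu>) (indicator D))"
      unfolding \<open>N1 = N2\<close> N2_def by (rule nn_integral_bind[OF f J])
    also have "\<dots> = (\<integral>\<^sup>+\<omega>. ?Jf \<omega> * indicator D \<omega> \<partial>Pr \<mu>)"
      using measurable_from_subalg[OF subalg Jf]
      by (subst nn_integral_density) (auto simp: mult.commute)
    finally show "(\<integral>\<^sup>+\<omega>\<in>D. ?f \<omega> \<partial>Pr \<mu>) = (\<integral>\<^sup>+\<omega>\<in>D. ?Jf \<omega> \<partial>Pr \<mu>)" .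
  qed measurable
  then have "(\<integral>\<^sup>+\<omega>. g \<omega> * ?Jf \<omega> \<partial>Pr \<mu>) = (\<integral>\<^sup>+\<omega>. g \<omega> * nn_cond_exp (Pr \<mu>) (\<G> n) ?f \<omega> \<partial>Pr \<mu>)"
    by (intro nn_integral_cong_AE) auto
  also have "\<dots> = (\<integral>\<^sup>+\<omega>. g \<omega> * ?f \<omega> \<partial>Pr \<mu>)"
    by (rule nn_cond_exp_intg[OF g]) measurable
  finally show ?thesis ..
qed

end

section \<open>The eigenfunction\<close>

context split_chain
begin

text \<open>The contribution of the event that the first cycle has length \<open>j + 1\<close> to the expectation of
  \<open>exp (\<theta> \<bullet> S\<^sub>\<tau> - \<tau> \<zeta>)\<close>, as a kernel iterate. In contrast to the expectation itself, which involves
  the laws started at all \<open>x\<close>, it is visibly measurable in \<open>x\<close>.\<close>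

primrec cycle_term :: "'v \<Rightarrow> real \<Rightarrow> nat \<Rightarrow> 'x \<Rightarrow> ennreal" where
  "cycle_term \<theta> \<zeta> 0 x = (\<integral>\<^sup>+(y, s). ennreal (exp (\<theta> \<bullet> s - \<zeta>)) \<partial>split_kernel True x)"
| "cycle_term \<theta> \<zeta> (Suc j) x =
     (\<integral>\<^sup>+(y, s). ennreal (exp (\<theta> \<bullet> s - \<zeta>)) * cycle_term \<theta> \<zeta> j y \<partial>split_kernel False x)"

text \<open>The expectation of \<open>exp (\<theta> \<bullet> S\<^sub>\<tau> - \<tau> \<zeta>)\<close> for the chain started at \<open>x\<close> (see \<open>cycle_mgf_return\<close>),
  possibly infinite. At \<open>\<zeta> = \<psi>\<close> it is the eigenfunction.\<close>

definition cycle_fun :: "'v \<Rightarrow> real \<Rightarrow> 'x \<Rightarrow> ennreal" where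
  "cycle_fun \<theta> \<zeta> x = (\<Sum>j. cycle_term \<theta> \<zeta> j x)"

definition tilt :: "'v \<Rightarrow> real \<Rightarrow> nat \<Rightarrow> 'w \<Rightarrow> ennreal" where
  "tilt \<theta> \<zeta> n \<omega> = ennreal (exp (\<theta> \<bullet> S n \<omega> - real n * \<zeta>))"

lemma nn_integral_split_kernel_measurable:
  assumes "f \<in> borel_measurable (\<X> \<Otimes>\<^sub>M borel)"
  shows "(\<lambda>x. \<integral>\<^sup>+z. f z \<partial>split_kernel b x) \<in> borel_measurable \<X>"
  by (rule measurable_compose[OF split_kernel_measurable nn_integral_measurable_subprob_algebra[OF assms]])

lemma cycle_term_measurable [measurable]: "cycle_term \<theta> \<zeta> j \<in> borel_measurable \<X>"
proof (induction j)
  case 0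
  show ?case unfolding cycle_term.simps(1)[abs_def]
    by (rule nn_integral_split_kernel_measurable) measurable
next
  case (Suc j)
  note [measurable] = Suc
  show ?case unfolding cycle_term.simps(2)[abs_def]
    by (rule nn_integral_split_kernel_measurable) measurable
qed

lemma cycle_fun_measurable [measurable]: "cycle_fun \<theta> \<zeta> \<in> borel_measurable \<X>"
  unfolding cycle_fun_def[abs_def] by measurable

lemma tilt_Suc: "tilt \<theta> \<zeta> (Suc n) \<omega> = tilt \<theta> \<zeta> n \<omega> * ennreal (exp (\<theta> \<bullet> \<xi> (Suc n) \<omega> - \<zeta>))"
  unfolding tilt_def
  by (simp add: incr_def inner_diff_right algebra_simps flip: ennreal_mult exp_add)

lemma tilt_measurable_G: "i \<le> n \<Longrightarrow> tilt \<theta> \<zeta> i \<in> borel_measurable (\<G> n)"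
proof -
  assume "i \<le> n"
  then have [measurable]: "S i \<in> borel_measurable (\<G> n)" by (rule S_measurable_G)
  show ?thesis unfolding tilt_def[abs_def] by measurable
qed

text \<open>For \<open>n = 0\<close> this identifies \<open>cycle_term\<close> with its probabilistic meaning. A general \<open>n\<close> is needed
  for the induction: expanding one kernel moves the chain one step ahead within a cycle that has not
  ended yet.\<close>

lemma nn_integral_cycle_term:
  assumes \<mu>: "\<mu> \<in> space (prob_algebra \<X>)"
  shows "(\<integral>\<^sup>+\<omega>. (if \<forall>i\<in>{1..n}. \<not> Y i \<omega> then tilt \<theta> \<zeta> n \<omega> else 0) * cycle_term \<theta> \<zeta> j (X n \<omega>) \<partial>Pr \<mu>) =
    (\<integral>\<^sup>+\<omega>. (if regen_time Y 1 \<omega> = enat (n + Suc j) then tilt \<theta> \<zeta> (n + Suc j) \<omega> else 0) \<partial>Pr \<mu>)"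
proof (induction j arbitrary: n)
  have [measurable]: "Measurable.pred (\<G> n) (\<lambda>\<omega>. \<forall>i\<in>{1..n}. \<not> Y i \<omega>)" for n
    by (intro pred_intros_finite pred_intros_logic measurable_regeneration_event) auto
  note [measurable] = tilt_measurable_G[OF order_refl]
  have g: "(\<lambda>\<omega>. if \<forall>i\<in>{1..n}. \<not> Y i \<omega> then tilt \<theta> \<zeta> n \<omega> else 0) \<in> borel_measurable (\<G> n)" for n
    by measurable
  {
    case 0
    have "(\<integral>\<^sup>+\<omega>. (if \<forall>i\<in>{1..n}. \<not> Y i \<omega> then tilt \<theta> \<zeta> n \<omega> else 0) * cycle_term \<theta> \<zeta> 0 (X n \<omega>) \<partial>Pr \<mu>) =
        (\<integral>\<^sup>+\<omega>. (if \<forall>i\<in>{1..n}. \<not> Y i \<omega> then tilt \<theta> \<zeta> n \<omega> else 0) * (if Y (Suc n) \<omega> = True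
          then (\<lambda>(y, s). ennreal (exp (\<theta> \<bullet> s - \<zeta>))) (X (Suc n) \<omega>, \<xi> (Suc n) \<omega>) else 0) \<partial>Pr \<mu>)"
      unfolding cycle_term.simps by (rule split_markov[OF \<mu> _ g, symmetric]) measurable
    also have "\<dots> = (\<integral>\<^sup>+\<omega>. (if regen_time Y 1 \<omega> = enat (n + Suc 0) then tilt \<theta> \<zeta> (n + Suc 0) \<omega> else 0) \<partial>Pr \<mu>)"
    proof (rule nn_integral_cong)
      fix \<omega>
      have "regen_time Y 1 \<omega> = enat (n + Suc 0) \<longleftrightarrow> Y (Suc n) \<omega> \<and> (\<forall>i\<in>{1..n}. \<not> Y i \<omega>)"
        unfolding regen_time_1_eq_iff by (auto simp: less_Suc_eq_le)
      then show "(if \<forall>i\<in>{1..n}. \<not> Y i \<omega> then tilt \<theta> \<zeta> n \<omega> else 0) * (if Y (Suc n) \<omega> = True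
          then (\<lambda>(y, s). ennreal (exp (\<theta> \<bullet> s - \<zeta>))) (X (Suc n) \<omega>, \<xi> (Suc n) \<omega>) else 0) =
          (if regen_time Y 1 \<omega> = enat (n + Suc 0) then tilt \<theta> \<zeta> (n + Suc 0) \<omega> else 0)"
        by (auto simp: tilt_Suc simp del: regen_time.simps One_nat_def)
    qed
    finally show ?case .
  next
    case (Suc j)
    have "(\<integral>\<^sup>+\<omega>. (if \<forall>i\<in>{1..n}. \<not> Y i \<omega> then tilt \<theta> \<zeta> n \<omega> else 0) * cycle_term \<theta> \<zeta> (Suc j) (X n \<omega>) \<partial>Pr \<mu>) =
        (\<integral>\<^sup>+\<omega>. (if \<forall>i\<in>{1..n}. \<not> Y i \<omega> then tilt \<theta> \<zeta> n \<omega> else 0) * (if Y (Suc n) \<omega> = False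
          then (\<lambda>(y, s). ennreal (exp (\<theta> \<bullet> s - \<zeta>)) * cycle_term \<theta> \<zeta> j y) (X (Suc n) \<omega>, \<xi> (Suc n) \<omega>)
          else 0) \<partial>Pr \<mu>)"
      unfolding cycle_term.simps by (rule split_markov[OF \<mu> _ g, symmetric]) measurable
    also have "\<dots> = (\<integral>\<^sup>+\<omega>. (if \<forall>i\<in>{1..Suc n}. \<not> Y i \<omega> then tilt \<theta> \<zeta> (Suc n) \<omega> else 0)
        * cycle_term \<theta> \<zeta> j (X (Suc n) \<omega>) \<partial>Pr \<mu>)"
      by (intro nn_integral_cong) (auto simp: tilt_Suc atLeastAtMostSuc_conv mult.assoc)
    also note Suc
    finally show ?case by (simp only: add_Suc add_Suc_right)
  }
qed

text \<open>The first cycle is split according to its length; since \<open>\<tau> \<ge> 1\<close>, all lengths have the form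
  \<open>Suc j\<close>.\<close>

lemma cycle_mgf_eq:
  assumes \<mu>: "\<mu> \<in> space (prob_algebra \<X>)"
  shows "cycle_mgf (Pr \<mu>) S Y \<theta> \<zeta> = (\<integral>\<^sup>+x. cycle_fun \<theta> \<zeta> x \<partial>\<mu>)"
proof -
  note [measurable] = X_measurable S_measurable regen_time_eq_measurable
  note [measurable_cong] = law_cong(2)[OF \<mu>]
  have [measurable_cong]: "sets \<mu> = sets \<X>" using \<mu> by (simp add: space_prob_algebra)
  define a where "a j \<omega> = (if regen_time Y 1 \<omega> = enat (Suc j) then tilt \<theta> \<zeta> (Suc j) \<omega> else 0)" for j \<omega>
  have a [measurable]: "a j \<in> borel_measurable (Pr \<mu>)" for j
    unfolding a_def[abs_def] tilt_def[abs_def] by measurable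
  have "(case regen_time Y 1 \<omega> of enat n \<Rightarrow> ennreal (exp (\<theta> \<bullet> S n \<omega> - real n * \<zeta>)) | \<infinity> \<Rightarrow> 0) = (\<Sum>j. a j \<omega>)" for \<omega>
  proof (cases "regen_time Y 1 \<omega>")
    case (enat n)
    then obtain m where n: "n = Suc m" using regen_time_ge[of 1 Y \<omega>] by (cases n) auto
    have "(\<Sum>j. a j \<omega>) = (\<Sum>j\<in>{m}. a j \<omega>)"
      by (rule suminf_finite) (auto simp: a_def enat n simp del: regen_time.simps One_nat_def)
    then show ?thesis by (simp add: a_def enat n tilt_def del: regen_time.simps One_nat_def)
  qed (simp add: a_def del: regen_time.simps One_nat_def)
  then have "cycle_mgf (Pr \<mu>) S Y \<theta> \<zeta> = (\<Sum>j. \<integral>\<^sup>+\<omega>. a j \<omega> \<partial>Pr \<mu>)"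
    unfolding cycle_mgf_def by (simp add: nn_integral_suminf del: regen_time.simps One_nat_def)
  moreover have "(\<integral>\<^sup>+\<omega>. a j \<omega> \<partial>Pr \<mu>) = (\<integral>\<^sup>+x. cycle_term \<theta> \<zeta> j x \<partial>\<mu>)" for j
  proof -
    have "(\<integral>\<^sup>+\<omega>. a j \<omega> \<partial>Pr \<mu>) = (\<integral>\<^sup>+\<omega>. tilt \<theta> \<zeta> 0 \<omega> * cycle_term \<theta> \<zeta> j (X 0 \<omega>) \<partial>Pr \<mu>)"
      using nn_integral_cycle_term[OF \<mu>, of 0 \<theta> \<zeta> j, unfolded add_0] by (simp add: a_def del: regen_time.simps One_nat_def)
    also have "\<dots> = (\<integral>\<^sup>+\<omega>. cycle_term \<theta> \<zeta> j (X 0 \<omega>) \<partial>Pr \<mu>)"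
      using law_cong(3)[OF \<mu>] by (intro nn_integral_cong) (simp add: tilt_def S_0)
    also have "\<dots> = (\<integral>\<^sup>+x. cycle_term \<theta> \<zeta> j x \<partial>distr (Pr \<mu>) \<X> (X 0))"
      by (subst nn_integral_distr) auto
    finally show ?thesis unfolding initial[OF \<mu>] .
  qed
  moreover have "(\<Sum>j. \<integral>\<^sup>+x. cycle_term \<theta> \<zeta> j x \<partial>\<mu>) = (\<integral>\<^sup>+x. cycle_fun \<theta> \<zeta> x \<partial>\<mu>)"
    unfolding cycle_fun_def by (rule nn_integral_suminf[symmetric]) measurable
  ultimately show ?thesis by simp
qed

lemma cycle_mgf_return:
  assumes "x \<in> space \<X>"
  shows "cycle_mgf (Pr (return \<X> x)) S Y \<theta> \<zeta> = cycle_fun \<theta> \<zeta> x"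
  using assms by (simp add: cycle_mgf_eq return_prob_algebra nn_integral_return)

text \<open>The cycle either ends with its first step, or it continues from the new state.\<close>

lemma cycle_fun_first_step:
  "cycle_fun \<theta> \<zeta> x =
     (\<integral>\<^sup>+(y, s). ennreal (exp (\<theta> \<bullet> s - \<zeta>)) \<partial>split_kernel True x) +
     (\<integral>\<^sup>+(y, s). ennreal (exp (\<theta> \<bullet> s - \<zeta>)) * cycle_fun \<theta> \<zeta> y \<partial>split_kernel False x)"
proof -
  have "cycle_fun \<theta> \<zeta> x = cycle_term \<theta> \<zeta> 0 x + (\<Sum>j. cycle_term \<theta> \<zeta> (Suc j) x)"
    unfolding cycle_fun_def using suminf_offset[of "\<lambda>j. cycle_term \<theta> \<zeta> j x" 1] by (simp add: summableI)
  also have "(\<Sum>j. cycle_term \<theta> \<zeta> (Suc j) x) =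
      (\<integral>\<^sup>+z. (\<Sum>j. ennreal (exp (\<theta> \<bullet> snd z - \<zeta>)) * cycle_term \<theta> \<zeta> j (fst z)) \<partial>split_kernel False x)"
    by (subst nn_integral_suminf) (simp_all add: case_prod_unfold)
  also have "\<dots> = (\<integral>\<^sup>+(y, s). ennreal (exp (\<theta> \<bullet> s - \<zeta>)) * cycle_fun \<theta> \<zeta> y \<partial>split_kernel False x)"
    by (simp add: case_prod_unfold cycle_fun_def)
  finally show ?thesis by simp
qed

text \<open>At a regeneration the new state has law \<open>\<nu>\<close> and is independent of the increment, so that the
  factor \<open>cycle_fun\<close> integrates to \<open>1\<close> separately.\<close>

lemma cycle_fun_at_regeneration:
  assumes root: "cycle_mgf (Pr \<nu>) S Y \<theta> \<psi> = 1" and x: "x \<in> space \<X>"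
  shows "(\<integral>\<^sup>+(y, s). ennreal (exp (\<theta> \<bullet> s - \<zeta>)) * cycle_fun \<theta> \<psi> y \<partial>split_kernel True x) =
    (\<integral>\<^sup>+(y, s). ennreal (exp (\<theta> \<bullet> s - \<zeta>)) \<partial>split_kernel True x)"
proof -
  interpret h: subprob_space "h x"
    using measurable_space[OF h_kernel x] by (simp add: space_subprob_algebra)
  interpret \<nu>: prob_space \<nu> using nu by (simp add: space_prob_algebra)
  have [measurable_cong]: "sets \<nu> = sets \<X>" "sets (h x) = sets borel"
    using nu measurable_space[OF h_kernel x] by (auto simp: space_subprob_algebra space_prob_algebra)
  define K where "K = (\<integral>\<^sup>+s. ennreal (exp (\<theta> \<bullet> s - \<zeta>)) \<partial>h x)"
  have "(\<integral>\<^sup>+(y, s). ennreal (exp (\<theta> \<bullet> s - \<zeta>)) * cycle_fun \<theta> \<psi> y \<partial>split_kernel True x) =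
      (\<integral>\<^sup>+y. \<integral>\<^sup>+s. ennreal (exp (\<theta> \<bullet> s - \<zeta>)) * cycle_fun \<theta> \<psi> y \<partial>h x \<partial>\<nu>)"
    unfolding split_kernel_True[OF x] by (subst h.nn_integral_fst[symmetric]) auto
  also have "\<dots> = K * (\<integral>\<^sup>+y. cycle_fun \<theta> \<psi> y \<partial>\<nu>)"
    by (simp add: nn_integral_multc nn_integral_cmult K_def)
  also have "(\<integral>\<^sup>+y. cycle_fun \<theta> \<psi> y \<partial>\<nu>) = 1"
    using root cycle_mgf_eq[OF nu] by simp
  also have "K * 1 = (\<integral>\<^sup>+(y, s). ennreal (exp (\<theta> \<bullet> s - \<zeta>)) \<partial>split_kernel True x)"
    unfolding split_kernel_True[OF x]
    by (subst h.nn_integral_fst[symmetric]) (auto simp: K_def \<nu>.emeasure_space_1)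
  finally show ?thesis .
qed

lemma cycle_psi_root:
  assumes finite: "AE \<omega> in Pr \<nu>. regen_time Y 1 \<omega> < \<infinity>"
    and "open": "open (mgf_domain (Pr \<nu>) S Y)"
    and \<theta>: "\<theta> \<in> tilt_domain (Pr \<nu>) S Y"
  shows "cycle_mgf (Pr \<nu>) S Y \<theta> (cycle_psi (Pr \<nu>) S Y \<theta>) = 1"
proof -
  note [measurable] = S_measurable regen_time_eq_measurable
  note [measurable_cong] = law_cong(2)[OF nu]
  interpret prob_space "Pr \<nu>" by (rule law_cong(1)[OF nu])
  define \<tau> where "\<tau> = regen_time Y 1"
  have [measurable]: "\<tau> \<in> W \<rightarrow>\<^sub>M count_space UNIV"
  proof (subst measurable_count_space_eq2_countable, intro conjI ballI)
    have [measurable]: "Measurable.pred W (\<lambda>\<omega>. \<tau> \<omega> = enat n)" for n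
      unfolding \<tau>_def by (rule regen_time_eq_measurable)
    have infty: "\<tau> \<omega> = \<infinity> \<longleftrightarrow> (\<forall>n. \<not> \<tau> \<omega> = enat n)" for \<omega> by (cases "\<tau> \<omega>") auto
    have "Measurable.pred W (\<lambda>\<omega>. \<tau> \<omega> = \<infinity>)" unfolding infty by measurable
    then have "Measurable.pred W (\<lambda>\<omega>. \<tau> \<omega> = t)" for t by (cases t) auto
    then show "\<tau> -` {t} \<inter> space W \<in> sets W" for t
      by (simp add: pred_def vimage_def Int_def conj_commute)
  qed auto
  define f where "f \<omega> = (case \<tau> \<omega> of enat n \<Rightarrow> \<theta> \<bullet> S n \<omega> | \<infinity> \<Rightarrow> 0)" for \<omega>
  define N where "N \<omega> = (case \<tau> \<omega> of enat n \<Rightarrow> real n | \<infinity> \<Rightarrow> 1)" for \<omega>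
  have [measurable]: "f \<in> borel_measurable (Pr \<nu>)" "N \<in> borel_measurable (Pr \<nu>)"
    unfolding f_def[abs_def] N_def[abs_def] by measurable
  have mgf: "cycle_mgf (Pr \<nu>) S Y \<theta> \<zeta> = (\<integral>\<^sup>+\<omega>. ennreal (exp (f \<omega> - N \<omega> * \<zeta>)) \<partial>Pr \<nu>)" for \<zeta>
    unfolding cycle_mgf_def using finite
    by (intro nn_integral_cong_AE) (auto simp: f_def N_def \<tau>_def split: enat.splits)
  have "\<exists>!\<zeta>. (\<integral>\<^sup>+\<omega>. ennreal (exp (f \<omega> - N \<omega> * \<zeta>)) \<partial>Pr \<nu>) = 1"
  proof -
    obtain \<zeta>0 where \<zeta>0: "(\<theta>, \<zeta>0) \<in> mgf_domain (Pr \<nu>) S Y"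
      using \<theta> by (auto simp: tilt_domain_def)
    have "1 \<le> N \<omega>" for \<omega>
      using regen_time_ge[of 1 Y \<omega>] unfolding N_def \<tau>_def
      by (cases "regen_time Y 1 \<omega>") (simp_all del: regen_time.simps One_nat_def)
    then have "AE \<omega> in Pr \<nu>. 1 \<le> N \<omega>" by simp
    moreover have "open (Pair \<theta> -` mgf_domain (Pr \<nu>) S Y)"
      using "open" by (intro open_vimage continuous_intros)
    then have "open {\<zeta>. (\<integral>\<^sup>+\<omega>. ennreal (exp (f \<omega> - N \<omega> * \<zeta>)) \<partial>Pr \<nu>) < \<infinity>}"
      by (simp add: mgf_domain_def mgf vimage_def)
    moreover have "(\<integral>\<^sup>+\<omega>. ennreal (exp (f \<omega> - N \<omega> * \<zeta>0)) \<partial>Pr \<nu>) < \<infinity>"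
      using \<zeta>0 by (simp add: mgf_domain_def mgf)
    ultimately show ?thesis
      by (intro laplace_transform_root) (simp_all add: emeasure_space_1)
  qed
  then show ?thesis unfolding cycle_psi_def mgf by (rule theI')
qed

end

section \<open>The exponential martingale\<close>

context split_chain
begin

text \<open>The version of \<open>tilted_process\<close> with values in \<open>[0, \<infinity>]\<close>. It differs from the real one where the
  eigenfunction is infinite.\<close>

definition tilted :: "'v \<Rightarrow> real \<Rightarrow> ('w \<Rightarrow> enat) \<Rightarrow> nat \<Rightarrow> 'w \<Rightarrow> ennreal" where
  "tilted \<theta> \<psi> T n \<omega> =
     (if enat n < next_regen Y T \<omega> then tilt \<theta> \<psi> n \<omega> * cycle_fun \<theta> \<psi> (X n \<omega>)
      else tilt \<theta> \<psi> (the_enat (next_regen Y T \<omega>)) \<omega>)"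

lemma less_next_regen_measurable:
  assumes "extended_stopping_time W \<F> T"
  shows "Measurable.pred (\<G> n) (\<lambda>\<omega>. enat n < next_regen Y T \<omega>)"
proof -
  have eq: "enat n < next_regen Y T \<omega> \<longleftrightarrow> \<not> (\<exists>u\<in>{..n}. next_regen Y T \<omega> = enat u)" for \<omega>
    by (cases "next_regen Y T \<omega>") auto
  show ?thesis unfolding eq
    by (intro pred_intros_logic pred_intros_finite next_regen_eq_measurable assms) auto
qed

lemma tilted_measurable:
  assumes T: "extended_stopping_time W \<F> T"
  shows "tilted \<theta> \<psi> T n \<in> borel_measurable (\<G> n)"
proof -
  note [measurable] = X_measurable_G[OF order_refl] tilt_measurable_G[OF order_refl]
  have eq: "tilted \<theta> \<psi> T n \<omega> =
      (if enat n < next_regen Y T \<omega> then tilt \<theta> \<psi> n \<omega> * cycle_fun \<theta> \<psi> (X n \<omega>) else 0) +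
      (\<Sum>u\<in>{..n}. if next_regen Y T \<omega> = enat u then tilt \<theta> \<psi> u \<omega> else 0)" for \<omega>
  proof (cases "next_regen Y T \<omega>")
    case (enat u)
    have "(\<Sum>u'\<in>{..n}. if next_regen Y T \<omega> = enat u' then tilt \<theta> \<psi> u' \<omega> else 0) =
        (if u \<le> n then tilt \<theta> \<psi> u \<omega> else 0)"
      by (simp add: enat sum.delta)
    then show ?thesis by (auto simp: tilted_def enat)
  qed (simp add: tilted_def)
  have "(\<lambda>\<omega>. if next_regen Y T \<omega> = enat u then tilt \<theta> \<psi> u \<omega> else 0) \<in> borel_measurable (\<G> n)"
    if "u \<in> {..n}" for u
  proof -
    have [measurable]: "Measurable.pred (\<G> n) (\<lambda>\<omega>. next_regen Y T \<omega> = enat u)"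
      "tilt \<theta> \<psi> u \<in> borel_measurable (\<G> n)"
      using that by (auto intro!: next_regen_eq_measurable T tilt_measurable_G)
    show ?thesis by measurable
  qed
  moreover have "(\<lambda>\<omega>. if enat n < next_regen Y T \<omega> then tilt \<theta> \<psi> n \<omega> * cycle_fun \<theta> \<psi> (X n \<omega>) else 0)
      \<in> borel_measurable (\<G> n)"
    using less_next_regen_measurable[OF T, of n] by (intro measurable_If) (simp_all add: pred_def)
  ultimately have "(\<lambda>\<omega>. (if enat n < next_regen Y T \<omega> then tilt \<theta> \<psi> n \<omega> * cycle_fun \<theta> \<psi> (X n \<omega>) else 0) +
      (\<Sum>u\<in>{..n}. if next_regen Y T \<omega> = enat u then tilt \<theta> \<psi> u \<omega> else 0)) \<in> borel_measurable (\<G> n)"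
    by (intro borel_measurable_add borel_measurable_sum)
  moreover note eq
  ultimately show ?thesis by (simp cong: measurable_cong)
qed

text \<open>Before \<open>U\<close>, the step to time \<open>Suc n\<close> freezes the process only if \<open>T \<le> n\<close> and a regeneration takes
  place; regenerations up to and including time \<open>T\<close> let it run on. Each summand of the
  bracket is the product of a factor known at time \<open>n\<close> and a function of the next step, as \<open>split_markov\<close> requires.\<close>

lemma tilted_Suc:
  "tilted \<theta> \<psi> T (Suc n) \<omega> =
     (if enat n < next_regen Y T \<omega> then 0 else tilted \<theta> \<psi> T n \<omega>) +
     ((if enat n < next_regen Y T \<omega> \<and> T \<omega> < enat (Suc n) then tilt \<theta> \<psi> n \<omega> else 0) *
        (if Y (Suc n) \<omega> = True then ennreal (exp (\<theta> \<bullet> \<xi> (Suc n) \<omega> - \<psi>)) else 0) +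
      ((if enat n < next_regen Y T \<omega> \<and> \<not> T \<omega> < enat (Suc n) then tilt \<theta> \<psi> n \<omega> else 0) *
        (if Y (Suc n) \<omega> = True
         then ennreal (exp (\<theta> \<bullet> \<xi> (Suc n) \<omega> - \<psi>)) * cycle_fun \<theta> \<psi> (X (Suc n) \<omega>) else 0) +
       (if enat n < next_regen Y T \<omega> then tilt \<theta> \<psi> n \<omega> else 0) *
        (if Y (Suc n) \<omega> = False
         then ennreal (exp (\<theta> \<bullet> \<xi> (Suc n) \<omega> - \<psi>)) * cycle_fun \<theta> \<psi> (X (Suc n) \<omega>) else 0)))"
proof (cases "enat n < next_regen Y T \<omega>")
  case False
  then have "\<not> enat (Suc n) < next_regen Y T \<omega>"
    by (cases "next_regen Y T \<omega>") auto
  with False show ?thesis by (simp add: tilted_def)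
next
  case True
  have less: "enat (Suc n) < next_regen Y T \<omega> \<longleftrightarrow> \<not> (T \<omega> < enat (Suc n) \<and> Y (Suc n) \<omega>)"
    using True unfolding less_next_regen_iff by (auto simp: le_Suc_eq)
  have eq: "next_regen Y T \<omega> = enat (Suc n)" if "T \<omega> < enat (Suc n)" "Y (Suc n) \<omega>"
    using True that unfolding less_next_regen_iff next_regen_eq_enat_iff by (auto simp: less_Suc_eq_le)
  show ?thesis
    using True less eq by (auto simp: tilted_def tilt_Suc mult.assoc)
qed

text \<open>The regenerating steps up to \<open>T\<close> are brought to the form of those after \<open>T\<close> by
  \<open>cycle_fun_at_regeneration\<close>; then both groups are summed by \<open>cycle_fun_first_step\<close>.\<close>

lemma nn_integral_tilted_Suc:
  assumes \<mu>: "\<mu> \<in> space (prob_algebra \<X>)" and T: "extended_stopping_time W \<F> T"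
    and root: "cycle_mgf (Pr \<nu>) S Y \<theta> \<psi> = 1" and D: "D \<in> sets (\<G> n)"
  shows "(\<integral>\<^sup>+\<omega>\<in>D. tilted \<theta> \<psi> T (Suc n) \<omega> \<partial>Pr \<mu>) = (\<integral>\<^sup>+\<omega>\<in>D. tilted \<theta> \<psi> T n \<omega> \<partial>Pr \<mu>)"
proof -
  note [measurable] = X_measurable Y_measurable X_measurable_G[OF order_refl]
    tilt_measurable_G[OF order_refl] tilted_measurable[OF T] D
  note [measurable_cong] = law_cong(2)[OF \<mu>]
  let ?e = "\<lambda>(y, s). ennreal (exp (\<theta> \<bullet> s - \<psi>))"
  let ?r = "\<lambda>(y, s). ennreal (exp (\<theta> \<bullet> s - \<psi>)) * cycle_fun \<theta> \<psi> y"
  let ?f = "\<lambda>b f \<omega>. if Y (Suc n) \<omega> = b then f (X (Suc n) \<omega>, \<xi> (Suc n) \<omega>) else 0"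
  let ?J = "\<lambda>b f \<omega>. \<integral>\<^sup>+z. f z \<partial>split_kernel b (X n \<omega>)"
  \<comment> \<open>The weights \<open>g0\<close> to \<open>g3\<close> are the factors in \<open>tilted_Suc\<close> that are known at time \<open>n\<close>.\<close>
  define alive where "alive \<omega> \<longleftrightarrow> enat n < next_regen Y T \<omega>" for \<omega>
  define stopped where "stopped \<omega> \<longleftrightarrow> T \<omega> < enat (Suc n)" for \<omega>
  have [measurable]: "Measurable.pred (\<G> n) alive" "Measurable.pred (\<G> n) stopped"
    unfolding alive_def[abs_def] stopped_def[abs_def]
    by (rule less_next_regen_measurable[OF T] stopping_time_less_measurable[OF T order_refl])+
  define g0 where "g0 \<omega> = (if alive \<omega> then 0 else tilted \<theta> \<psi> T n \<omega>) * indicator D \<omega>" for \<omega>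
  define g1 where "g1 \<omega> = (if alive \<omega> \<and> stopped \<omega> then tilt \<theta> \<psi> n \<omega> else 0) * indicator D \<omega>" for \<omega>
  define g2 where "g2 \<omega> = (if alive \<omega> \<and> \<not> stopped \<omega> then tilt \<theta> \<psi> n \<omega> else 0) * indicator D \<omega>" for \<omega>
  define g3 where "g3 \<omega> = (if alive \<omega> then tilt \<theta> \<psi> n \<omega> else 0) * indicator D \<omega>" for \<omega>
  have g: "g0 \<in> borel_measurable (\<G> n)" "g1 \<in> borel_measurable (\<G> n)"
    "g2 \<in> borel_measurable (\<G> n)" "g3 \<in> borel_measurable (\<G> n)"
    unfolding g0_def[abs_def] g1_def[abs_def] g2_def[abs_def] g3_def[abs_def] by measurable
  note [measurable] = g[THEN measurable_from_subalg[OF subalgebra_law[OF \<mu>]]]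
  have er: "?e \<in> borel_measurable (\<X> \<Otimes>\<^sub>M borel)" "?r \<in> borel_measurable (\<X> \<Otimes>\<^sub>M borel)"
    by measurable
  have J [measurable]: "?J b f \<in> borel_measurable (Pr \<mu>)"
    if "f \<in> borel_measurable (\<X> \<Otimes>\<^sub>M borel)" for b and f :: "'x \<times> 'v \<Rightarrow> ennreal"
    by (rule measurable_compose[OF _ nn_integral_split_kernel_measurable[OF that]]) measurable
  note J' [measurable] = J[OF er(1), of True] J[OF er(2), of False] J[OF er(2), of True]
  have F [measurable]: "?f b f \<in> borel_measurable (Pr \<mu>)"
    if [measurable]: "f \<in> borel_measurable (\<X> \<Otimes>\<^sub>M borel)" for b and f :: "'x \<times> 'v \<Rightarrow> ennreal"
    by measurable
  note F' [measurable] = F[OF er(1), of True] F[OF er(2), of False] F[OF er(2), of True]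
  have "(\<integral>\<^sup>+\<omega>\<in>D. tilted \<theta> \<psi> T (Suc n) \<omega> \<partial>Pr \<mu>) =
      (\<integral>\<^sup>+\<omega>. g0 \<omega> + (g1 \<omega> * ?f True ?e \<omega> + (g2 \<omega> * ?f True ?r \<omega> + g3 \<omega> * ?f False ?r \<omega>)) \<partial>Pr \<mu>)"
    unfolding tilted_Suc g0_def g1_def g2_def g3_def alive_def stopped_def
    by (intro nn_integral_cong) (simp add: distrib_right mult_ac)
  also have "\<dots> = (\<integral>\<^sup>+\<omega>. g0 \<omega> \<partial>Pr \<mu>) + ((\<integral>\<^sup>+\<omega>. g1 \<omega> * ?f True ?e \<omega> \<partial>Pr \<mu>) +
      ((\<integral>\<^sup>+\<omega>. g2 \<omega> * ?f True ?r \<omega> \<partial>Pr \<mu>) + (\<integral>\<^sup>+\<omega>. g3 \<omega> * ?f False ?r \<omega> \<partial>Pr \<mu>)))"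
    by (simp only: nn_integral_add borel_measurable_add borel_measurable_times_ennreal F'
        g[THEN measurable_from_subalg[OF subalgebra_law[OF \<mu>]]])
  also have "\<dots> = (\<integral>\<^sup>+\<omega>. g0 \<omega> \<partial>Pr \<mu>) + ((\<integral>\<^sup>+\<omega>. g1 \<omega> * ?J True ?e \<omega> \<partial>Pr \<mu>) +
      ((\<integral>\<^sup>+\<omega>. g2 \<omega> * ?J True ?r \<omega> \<partial>Pr \<mu>) + (\<integral>\<^sup>+\<omega>. g3 \<omega> * ?J False ?r \<omega> \<partial>Pr \<mu>)))"
    by (simp only: split_markov[OF \<mu> er(1) g(2)] split_markov[OF \<mu> er(2) g(3)]
        split_markov[OF \<mu> er(2) g(4)])
  also have "\<dots> = (\<integral>\<^sup>+\<omega>. g0 \<omega> + (g1 \<omega> * ?J True ?e \<omega> + (g2 \<omega> * ?J True ?r \<omega> + g3 \<omega> * ?J False ?r \<omega>)) \<partial>Pr \<mu>)"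
    by (simp only: nn_integral_add borel_measurable_add borel_measurable_times_ennreal J'
        g[THEN measurable_from_subalg[OF subalgebra_law[OF \<mu>]]])
  also have "\<dots> = (\<integral>\<^sup>+\<omega>\<in>D. tilted \<theta> \<psi> T n \<omega> \<partial>Pr \<mu>)"
  proof (rule nn_integral_cong)
    fix \<omega> assume "\<omega> \<in> space (Pr \<mu>)"
    then have X: "X n \<omega> \<in> space \<X>"
      using law_cong(3)[OF \<mu>] measurable_space[OF X_measurable] by auto
    have "g1 \<omega> + g2 \<omega> = g3 \<omega>" by (simp add: g1_def g2_def g3_def)
    then have "g0 \<omega> + (g1 \<omega> * ?J True ?e \<omega> + (g2 \<omega> * ?J True ?r \<omega> + g3 \<omega> * ?J False ?r \<omega>)) =
        g0 \<omega> + g3 \<omega> * (?J True ?e \<omega> + ?J False ?r \<omega>)"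
      unfolding cycle_fun_at_regeneration[OF root X]
      by (simp add: distrib_left distrib_right add.assoc flip: \<open>g1 \<omega> + g2 \<omega> = g3 \<omega>\<close>)
    also have "\<dots> = g0 \<omega> + g3 \<omega> * cycle_fun \<theta> \<psi> (X n \<omega>)"
      by (subst cycle_fun_first_step) simp
    also have "\<dots> = tilted \<theta> \<psi> T n \<omega> * indicator D \<omega>"
      by (simp add: g0_def g3_def alive_def tilted_def mult_ac)
    finally show "g0 \<omega> + (g1 \<omega> * ?J True ?e \<omega> + (g2 \<omega> * ?J True ?r \<omega> + g3 \<omega> * ?J False ?r \<omega>)) =
        tilted \<theta> \<psi> T n \<omega> * indicator D \<omega>" .
  qed
  finally show ?thesis .
qed

lemma nn_integral_tilted:
  assumes \<mu>: "\<mu> \<in> space (prob_algebra \<X>)" and T: "extended_stopping_time W \<F> T"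
    and root: "cycle_mgf (Pr \<nu>) S Y \<theta> \<psi> = 1" and "m \<le> n" and D: "D \<in> sets (\<G> m)"
  shows "(\<integral>\<^sup>+\<omega>\<in>D. tilted \<theta> \<psi> T n \<omega> \<partial>Pr \<mu>) = (\<integral>\<^sup>+\<omega>\<in>D. tilted \<theta> \<psi> T m \<omega> \<partial>Pr \<mu>)"
  using \<open>m \<le> n\<close>
proof (induction n rule: dec_induct)
  case (step n)
  have "D \<in> sets (\<G> n)" using D sets_G_mono[OF step(1)] by blast
  from nn_integral_tilted_Suc[OF \<mu> T root this] step show ?case by simp
qed simp

lemma nn_integral_tilted_0:
  assumes x: "x \<in> space \<X>"
  shows "(\<integral>\<^sup>+\<omega>. tilted \<theta> \<psi> T 0 \<omega> \<partial>Pr (return \<X> x)) = cycle_fun \<theta> \<psi> x"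
proof -
  note \<mu> = return_prob_algebra[OF x]
  note [measurable] = X_measurable
  note [measurable_cong] = law_cong(2)[OF \<mu>]
  have "(\<integral>\<^sup>+\<omega>. tilted \<theta> \<psi> T 0 \<omega> \<partial>Pr (return \<X> x)) = (\<integral>\<^sup>+\<omega>. cycle_fun \<theta> \<psi> (X 0 \<omega>) \<partial>Pr (return \<X> x))"
  proof (rule nn_integral_cong)
    fix \<omega> assume "\<omega> \<in> space (Pr (return \<X> x))"
    then have "S 0 \<omega> = 0" using law_cong(3)[OF \<mu>] by (simp add: S_0)
    moreover have "enat 0 < next_regen Y T \<omega>"
      unfolding less_next_regen_iff by (simp flip: zero_enat_def)
    ultimately show "tilted \<theta> \<psi> T 0 \<omega> = cycle_fun \<theta> \<psi> (X 0 \<omega>)"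
      by (simp add: tilted_def tilt_def)
  qed
  also have "\<dots> = (\<integral>\<^sup>+y. cycle_fun \<theta> \<psi> y \<partial>distr (Pr (return \<X> x)) \<X> (X 0))"
    by (subst nn_integral_distr) auto
  also have "\<dots> = cycle_fun \<theta> \<psi> x"
    unfolding initial[OF \<mu>] by (rule nn_integral_return[OF x]) measurable
  finally show ?thesis .
qed

lemma tilted_process_eq:
  assumes "\<omega> \<in> space W"
  shows "tilted_process \<X> \<nu> Pr X S Y T \<theta> n \<omega> =
    enn2real (tilted \<theta> (cycle_psi (Pr \<nu>) S Y \<theta>) T n \<omega>)"
proof -
  have "X n \<omega> \<in> space \<X>" by (rule measurable_space[OF X_measurable assms])
  then show ?thesis
    by (simp add: tilted_process_def tilted_def Let_def eigenfun_def cycle_mgf_return tilt_def enn2real_mult)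
qed

lemma martingale_tilted_process:
  assumes root: "cycle_mgf (Pr \<nu>) S Y \<theta> (cycle_psi (Pr \<nu>) S Y \<theta>) = 1"
    and x: "x \<in> space \<X>" and r: "cycle_mgf (Pr (return \<X> x)) S Y \<theta> (cycle_psi (Pr \<nu>) S Y \<theta>) < \<infinity>"
    and T: "extended_stopping_time W \<F> T"
  shows "martingale (Pr (return \<X> x)) \<G> (tilted_process \<X> \<nu> Pr X S Y T \<theta>)"
proof -
  note \<mu> = return_prob_algebra[OF x]
  let ?\<psi> = "cycle_psi (Pr \<nu>) S Y \<theta>"
  interpret prob_space "Pr (return \<X> x)" by (rule law_cong(1)[OF \<mu>])
  show ?thesis
  proof (rule martingale_enn2real[where V="tilted \<theta> ?\<psi> T"])
    show "(\<integral>\<^sup>+\<omega>. tilted \<theta> ?\<psi> T n \<omega> \<partial>Pr (return \<X> x)) < \<infinity>" for n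
    proof -
      have "(\<integral>\<^sup>+\<omega>\<in>space W. tilted \<theta> ?\<psi> T n \<omega> \<partial>Pr (return \<X> x)) =
          (\<integral>\<^sup>+\<omega>\<in>space W. tilted \<theta> ?\<psi> T 0 \<omega> \<partial>Pr (return \<X> x))"
        by (rule nn_integral_tilted[OF \<mu> T root]) (simp, metis sets.top space_regen_filtration)
      moreover have "(\<integral>\<^sup>+\<omega>\<in>space W. tilted \<theta> ?\<psi> T i \<omega> \<partial>Pr (return \<X> x)) =
          (\<integral>\<^sup>+\<omega>. tilted \<theta> ?\<psi> T i \<omega> \<partial>Pr (return \<X> x))" for i
        using law_cong(3)[OF \<mu>] by (intro nn_integral_cong) simp
      ultimately show ?thesis
        using r by (simp add: nn_integral_tilted_0[OF x] cycle_mgf_return[OF x])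
    qed
  qed (use law_cong[OF \<mu>] in \<open>auto simp: filtration_G subalgebra_law[OF \<mu>] tilted_measurable[OF T]
      tilted_process_eq finite_measure_axioms intro: nn_integral_tilted[OF \<mu> T root]\<close>)
qed

end

theorem theorem3:
  fixes \<X> \<phi> \<nu> :: "'x measure"
    and P :: "'x \<Rightarrow> ('x \<times> 'v::euclidean_space) measure"
    and h :: "'x \<Rightarrow> 'v measure"
    and W :: "'w measure"
    and Pr :: "'x measure \<Rightarrow> 'w measure"
    and X :: "nat \<Rightarrow> 'w \<Rightarrow> 'x"
    and S :: "nat \<Rightarrow> 'w \<Rightarrow> 'v"
    and Y :: "nat \<Rightarrow> 'w \<Rightarrow> bool"
    and F :: "'x set" and x0 :: 'x
    and T :: "'w \<Rightarrow> enat" and \<theta> :: 'v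
  assumes "split_chain \<X> P \<phi> \<nu> h W Pr X S Y"
    and "AE \<omega> in Pr \<nu>. regen_time Y 1 \<omega> < \<infinity>"
    and "open (mgf_domain (Pr \<nu>) S Y)"
    and "(0, 0) \<in> mgf_domain (Pr \<nu>) S Y"
    and "full_set \<X> \<phi> F"
    and "\<And>x. x \<in> F \<Longrightarrow> AE \<omega> in Pr (return \<X> x). regen_time Y 1 \<omega> < \<infinity>"
    and "\<And>x \<theta> \<zeta>. x \<in> F \<Longrightarrow> (\<theta>, \<zeta>) \<in> mgf_domain (Pr \<nu>) S Y \<Longrightarrow>
           cycle_mgf (Pr (return \<X> x)) S Y \<theta> \<zeta> < \<infinity>"
    and "x0 \<in> F"
    and "extended_stopping_time W (map_filtration W \<X> X S) T"
    and "\<theta> \<in> tilt_domain (Pr \<nu>) S Y"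
  shows "martingale (Pr (return \<X> x0)) (regen_filtration W \<X> X S Y)
           (tilted_process \<X> \<nu> Pr X S Y T \<theta>)"
proof -
  interpret split_chain \<X> P \<phi> \<nu> h W Pr X S Y by fact
  have root: "cycle_mgf (Pr \<nu>) S Y \<theta> (cycle_psi (Pr \<nu>) S Y \<theta>) = 1"
    by (rule cycle_psi_root) fact+
  have "x0 \<in> space \<X>"
    using \<open>full_set \<X> \<phi> F\<close> \<open>x0 \<in> F\<close> sets.sets_into_space by (auto simp: full_set_def)
  moreover have "cycle_mgf (Pr (return \<X> x0)) S Y \<theta> (cycle_psi (Pr \<nu>) S Y \<theta>) < \<infinity>"
    by (rule assms(7)[OF \<open>x0 \<in> F\<close>]) (simp add: mgf_domain_def root)
  ultimately show ?thesis
    by (intro martingale_tilted_process root assms(9))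
qed

end
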